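(* Let $A$ be a uniform algebra on a compact Hausdorff space $\Omega$. The singly generated $A$-rigged modules are exactly (up to $A$-isometric isomorphism) the modules of the form $\overline{Af}$ (closure in $C(\Omega)$) with $f\in\mathcal{R}_E(\Omega)$ for some closed $E\subset\Omega$. That is: every singly generated $A$-rigged module is $A$-isometric to such an $\overline{Af}$, and every such $\overline{Af}$ is a singly generated $A$-rigged module.
   Context: A uniform algebra on a compact Hausdorff space $\Omega$ is a closed subalgebra of $C(\Omega)$ (complex continuous functions) which contains the constants and separates points. $A$ and submodules of $C(\Omega)$ carry the operator space structure inherited from $C(\Omega)$. A left operator module over $A$ is a complete operator space $X$ which is a unital left $A$-module with $\|[\sum_k a_{ik}x_{kj}]\|\le\|[a_{ij}]\|\|[x_{ij}]\|$ for all matrices over $A$ and $X$. It is singly generated if $Ax$ is dense in $X$ for some $x\in X$. $A$-isometric means isomorphic via a surjective isometric $A$-module map. $R_n(A)$ is $A^{(n)}$ with the operator space structure of the first row of $M_n(A)$. A left operator module $X$ is $A$-rigged if there exist a net of natural numbers $n_\alpha$ and completely contractive $A$-module maps $\phi_\alpha:X\to R_{n_\alpha}(A)$, $\psi_\alpha:R_{n_\alpha}(A)\to X$ such that $\psi_\alpha(\phi_\alpha(x))\to x$ for all $x\in X$ and, for every $\beta$, $\phi_\beta\circ\psi_\alpha\circ\phi_\alpha\to\phi_\beta$ in completely bounded norm. An $A$-tuple is an element of $A^{(n)}$ for some $n$, regarded as a function $\Omega\to\mathbb{C}^n$; $H\cdot K=\sum_ih_ik_i$ for $A$-tuples of equal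 length, and $\|\cdot\|_2$ is the Euclidean norm. For a closed subset $E\subset\Omega$, $\mathcal{R}_E(\Omega)$ is the set of $f\in C(\Omega)$ which vanish exactly on $E$ and for which there are two sequences $H_n,K_n$ of $A$-tuples ($H_n$, $K_n$ of the same length) such that (i) $\|K_n(w)\|_2\le f(w)\le\|H_n(w)\|_2^{-1}$ for all $w\in\Omega$ (with $\frac10=\infty$), and (ii) $H_n(w)\cdot K_n(w)\to1$ uniformly on compact subsets of $\Omega\setminus E$. *)

theory Defs
  imports "HOL-Analysis.Analysis" "HOL-Library.Function_Algebras"
begin

section \<open>The algebra of bounded continuous functions\<close>

text \<open>
  For a compact space \<open>\<Omega>\<close>, given as a type \<open>'w\<close> with \<open>compact UNIV\<close>, the type
  \<open>'w \<Rightarrow>\<^sub>C complex\<close> is \<open>C(\<Omega>)\<close>; its library norm is the supremum norm.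
  The library lacks the pointwise product.
\<close>

instantiation bcontfun :: (topological_space, real_normed_algebra_1) real_normed_algebra_1
begin

definition one_bcontfun :: "'a \<Rightarrow>\<^sub>C 'b"
  where "one_bcontfun = const_bcontfun 1"

definition times_bcontfun :: "('a \<Rightarrow>\<^sub>C 'b) \<Rightarrow> ('a \<Rightarrow>\<^sub>C 'b) \<Rightarrow> ('a \<Rightarrow>\<^sub>C 'b)"
  where "times_bcontfun f g = Bcontfun (\<lambda>x. f x * g x)"

lemma times_bcontfun_apply [simp]: "apply_bcontfun (f * g) x = f x * g x"
  for f g :: "'a \<Rightarrow>\<^sub>C 'b"
proof -
  have "(\<lambda>x. f x * g x) \<in> bcontfun"
  proof (rule bcontfun_normI)
    show "norm (f x * g x) \<le> norm f * norm g" for x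
      by (rule order_trans[OF norm_mult_ineq]) (intro mult_mono norm_bounded norm_ge_zero)
  qed (intro continuous_intros continuous_on_apply_bcontfun)
  then show ?thesis
    by (simp add: times_bcontfun_def Bcontfun_inverse)
qed

lemma one_bcontfun_apply [simp]: "apply_bcontfun (1 :: 'a \<Rightarrow>\<^sub>C 'b) x = 1"
  by (simp add: one_bcontfun_def)

instance
proof
  fix f g h :: "'a \<Rightarrow>\<^sub>C 'b" and r :: real
  show "f * g * h = f * (g * h)" "(f + g) * h = f * h + g * h" "f * (g + h) = f * g + f * h"
    "(r *\<^sub>R f) * g = r *\<^sub>R (f * g)" "f * (r *\<^sub>R g) = r *\<^sub>R (f * g)" "1 * f = f" "f * 1 = f"
    by (auto intro!: bcontfun_eqI simp: algebra_simps)
  show "(0 :: 'a \<Rightarrow>\<^sub>C 'b) \<noteq> 1"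
  proof
    assume "(0 :: 'a \<Rightarrow>\<^sub>C 'b) = 1"
    then have "apply_bcontfun (0 :: 'a \<Rightarrow>\<^sub>C 'b) undefined = apply_bcontfun 1 undefined"
      by simp
    then show False
      by simp
  qed
  show "norm (f * g) \<le> norm f * norm g"
  proof (rule norm_bound)
    show "norm (apply_bcontfun (f * g) x) \<le> norm f * norm g" for x
      by (simp, rule order_trans[OF norm_mult_ineq]) (intro mult_mono norm_bounded norm_ge_zero)
  qed
  show "norm (1 :: 'a \<Rightarrow>\<^sub>C 'b) = 1"
  proof (rule antisym)
    show "norm (1 :: 'a \<Rightarrow>\<^sub>C 'b) \<le> 1"
      by (rule norm_bound) simp
    show "1 \<le> norm (1 :: 'a \<Rightarrow>\<^sub>C 'b)"
      using norm_bounded[of "1 :: 'a \<Rightarrow>\<^sub>C 'b" undefined] by simp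
  qed
qed

end

instance bcontfun :: (topological_space, real_normed_field) comm_ring_1
proof
  fix f g :: "'a \<Rightarrow>\<^sub>C 'b"
  show "f * g = g * f"
    by (auto intro!: bcontfun_eqI simp: mult.commute)
qed (simp_all add: distrib_right)

definition uniform_algebra :: "('w::t2_space \<Rightarrow>\<^sub>C complex) set \<Rightarrow> bool"
  where "uniform_algebra A \<longleftrightarrow>
    closed A \<and>
    (\<forall>c. const_bcontfun c \<in> A) \<and>
    (\<forall>f\<in>A. \<forall>g\<in>A. f + g \<in> A \<and> f * g \<in> A) \<and>
    (\<forall>x y. x \<noteq> y \<longrightarrow> (\<exists>f\<in>A. f x \<noteq> f y))"


section \<open>Operator spaces and operator modules\<close>

text \<open>
  An \<open>m \<times> n\<close> matrix is a function \<open>nat \<Rightarrow> nat \<Rightarrow> _\<close> of which only the entries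
  with row index \<open>< m\<close> and column index \<open>< n\<close> are relevant.
\<close>

definition mat_over :: "nat \<Rightarrow> nat \<Rightarrow> 'x set \<Rightarrow> (nat \<Rightarrow> nat \<Rightarrow> 'x) set"
  where "mat_over m n S = {x. \<forall>i<m. \<forall>j<n. x i j \<in> S}"

text \<open>Norm of a complex matrix as an operator \<open>\<ell>\<^sup>2\<^sub>n \<rightarrow> \<ell>\<^sup>2\<^sub>m\<close>.\<close>

definition op_norm :: "nat \<Rightarrow> nat \<Rightarrow> (nat \<Rightarrow> nat \<Rightarrow> complex) \<Rightarrow> real"
  where "op_norm m n \<alpha> =
    (SUP v\<in>{v. L2_set (\<lambda>j. cmod (v j)) {..<n} \<le> 1}.
      L2_set (\<lambda>i. cmod (\<Sum>j<n. \<alpha> i j * v j)) {..<m})"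

definition dsum :: "nat \<Rightarrow> nat \<Rightarrow> (nat \<Rightarrow> nat \<Rightarrow> 'x) \<Rightarrow> (nat \<Rightarrow> nat \<Rightarrow> 'x) \<Rightarrow> nat \<Rightarrow> nat \<Rightarrow> 'x::zero"
  where "dsum m n x y = (\<lambda>i j.
    if i < m \<and> j < n then x i j else if m \<le> i \<and> n \<le> j then y (i - m) (j - n) else 0)"

text \<open>
  The addition is that of the type \<open>'x\<close>. The field \<open>mnorm\<close> takes the size of the matrix first.
  The field \<open>act\<close> is meaningful only on a function algebra \<open>A\<close> and on \<open>carr\<close>.
\<close>

record 'x op_space =
  carr :: "'x set"
  cscale :: "complex \<Rightarrow> 'x \<Rightarrow> 'x"
  mnorm :: "nat \<Rightarrow> nat \<Rightarrow> (nat \<Rightarrow> nat \<Rightarrow> 'x) \<Rightarrow> real"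

record (overloaded) ('w::topological_space, 'x) op_mod = "'x op_space" +
  act :: "('w \<Rightarrow>\<^sub>C complex) \<Rightarrow> 'x \<Rightarrow> 'x"

definition norm1 :: "('x, 'z) op_space_scheme \<Rightarrow> 'x \<Rightarrow> real"
  where "norm1 X x = mnorm X 1 1 (\<lambda>_ _. x)"

text \<open>
  Complete abstract operator spaces: matrix norms satisfying Ruan's axioms. The norms are given
  on rectangular matrices as well; \<open>ruan_mult\<close>, applied to coordinate inclusions and projections,
  makes them agree with the norms of square matrices obtained by padding with zeros.
  The axiom \<open>mnorm_cong\<close> reflects the encoding of matrices.
\<close>

locale complete_operator_space =
  fixes X :: "('x::ab_group_add, 'z) op_space_scheme"
  assumes zero_closed: "0 \<in> carr X"
    and add_closed: "\<And>x y. \<lbrakk>x \<in> carr X; y \<in> carr X\<rbrakk> \<Longrightarrow> x + y \<in> carr X"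
    and scale_closed: "\<And>c x. x \<in> carr X \<Longrightarrow> cscale X c x \<in> carr X"
    and scale_add_right: "\<And>c x y. \<lbrakk>x \<in> carr X; y \<in> carr X\<rbrakk> \<Longrightarrow> cscale X c (x + y) = cscale X c x + cscale X c y"
    and scale_add_left: "\<And>c d x. x \<in> carr X \<Longrightarrow> cscale X (c + d) x = cscale X c x + cscale X d x"
    and scale_scale: "\<And>c d x. x \<in> carr X \<Longrightarrow> cscale X c (cscale X d x) = cscale X (c * d) x"
    and scale_one: "\<And>x. x \<in> carr X \<Longrightarrow> cscale X 1 x = x"
    and mnorm_cong: "\<And>m n x y. (\<forall>i<m. \<forall>j<n. x i j = y i j) \<Longrightarrow> mnorm X m n x = mnorm X m n y"
    and mnorm_eq_0: "\<And>m n x. x \<in> mat_over m n (carr X) \<Longrightarrow>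
      mnorm X m n x = 0 \<longleftrightarrow> (\<forall>i<m. \<forall>j<n. x i j = 0)"
    and mnorm_triangle: "\<And>m n x y. \<lbrakk>x \<in> mat_over m n (carr X); y \<in> mat_over m n (carr X)\<rbrakk> \<Longrightarrow>
      mnorm X m n (\<lambda>i j. x i j + y i j) \<le> mnorm X m n x + mnorm X m n y"
    and mnorm_scale: "\<And>m n c x. x \<in> mat_over m n (carr X) \<Longrightarrow>
      mnorm X m n (\<lambda>i j. cscale X c (x i j)) = cmod c * mnorm X m n x"
    and ruan_mult: "\<And>m n p q \<alpha> \<beta> x. x \<in> mat_over p q (carr X) \<Longrightarrow>
      mnorm X m n (\<lambda>i j. \<Sum>k<p. \<Sum>l<q. cscale X (\<alpha> i k * \<beta> l j) (x k l))
        \<le> op_norm m p \<alpha> * mnorm X p q x * op_norm q n \<beta>"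
    and ruan_dsum: "\<And>m n p q x y. \<lbrakk>x \<in> mat_over m n (carr X); y \<in> mat_over p q (carr X)\<rbrakk> \<Longrightarrow>
      mnorm X (m + p) (n + q) (dsum m n x y) = max (mnorm X m n x) (mnorm X p q y)"
    and complete: "\<And>s. \<lbrakk>\<forall>k. s k \<in> carr X;
        \<forall>e>0. \<exists>N. \<forall>k\<ge>N. \<forall>l\<ge>N. norm1 X (s k - s l) < e\<rbrakk> \<Longrightarrow>
      \<exists>x\<in>carr X. (\<lambda>k. norm1 X (s k - x)) \<longlonglongrightarrow> 0"

text \<open>The norm of a matrix over \<open>C(\<Omega>)\<close>, that is, of a continuous matrix-valued function.\<close>

definition C_mnorm :: "nat \<Rightarrow> nat \<Rightarrow> (nat \<Rightarrow> nat \<Rightarrow> ('w::topological_space \<Rightarrow>\<^sub>C complex)) \<Rightarrow> real"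
  where "C_mnorm m n F = (SUP w. op_norm m n (\<lambda>i j. F i j w))"

locale left_operator_module = complete_operator_space X
  for A :: "('w::t2_space \<Rightarrow>\<^sub>C complex) set" and X :: "('w, 'x::ab_group_add) op_mod" +
  assumes act_closed: "\<And>a x. \<lbrakk>a \<in> A; x \<in> carr X\<rbrakk> \<Longrightarrow> act X a x \<in> carr X"
    and act_add_left: "\<And>a b x. \<lbrakk>a \<in> A; b \<in> A; x \<in> carr X\<rbrakk> \<Longrightarrow> act X (a + b) x = act X a x + act X b x"
    and act_add_right: "\<And>a x y. \<lbrakk>a \<in> A; x \<in> carr X; y \<in> carr X\<rbrakk> \<Longrightarrow> act X a (x + y) = act X a x + act X a y"
    and act_scale_left: "\<And>c a x. \<lbrakk>a \<in> A; x \<in> carr X\<rbrakk> \<Longrightarrow> act X (const_bcontfun c * a) x = cscale X c (act X a x)"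
    and act_scale_right: "\<And>c a x. \<lbrakk>a \<in> A; x \<in> carr X\<rbrakk> \<Longrightarrow> act X a (cscale X c x) = cscale X c (act X a x)"
    and act_mult: "\<And>a b x. \<lbrakk>a \<in> A; b \<in> A; x \<in> carr X\<rbrakk> \<Longrightarrow> act X (a * b) x = act X a (act X b x)"
    and act_one: "\<And>x. x \<in> carr X \<Longrightarrow> act X 1 x = x"
    and act_mnorm: "\<And>m n p a x. \<lbrakk>a \<in> mat_over m p A; x \<in> mat_over p n (carr X)\<rbrakk> \<Longrightarrow>
      mnorm X m n (\<lambda>i j. \<Sum>k<p. act X (a i k) (x k j)) \<le> C_mnorm m p a * mnorm X p n x"

definition singly_generated :: "('w::t2_space \<Rightarrow>\<^sub>C complex) set \<Rightarrow> ('w, 'x::ab_group_add) op_mod \<Rightarrow> bool"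
  where "singly_generated A X \<longleftrightarrow>
    (\<exists>x\<in>carr X. \<forall>y\<in>carr X. \<forall>e>0. \<exists>a\<in>A. norm1 X (y - act X a x) < e)"

definition module_map ::
  "('w::t2_space \<Rightarrow>\<^sub>C complex) set \<Rightarrow> ('w, 'x::ab_group_add) op_mod \<Rightarrow> ('w, 'y::ab_group_add) op_mod
    \<Rightarrow> ('x \<Rightarrow> 'y) \<Rightarrow> bool"
  where "module_map A X Y T \<longleftrightarrow>
    (\<forall>x\<in>carr X. T x \<in> carr Y) \<and>
    (\<forall>x\<in>carr X. \<forall>y\<in>carr X. T (x + y) = T x + T y) \<and>
    (\<forall>c. \<forall>x\<in>carr X. T (cscale X c x) = cscale Y c (T x)) \<and>
    (\<forall>a\<in>A. \<forall>x\<in>carr X. T (act X a x) = act Y a (T x))"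

definition A_isometric ::
  "('w::t2_space \<Rightarrow>\<^sub>C complex) set \<Rightarrow> ('w, 'x::ab_group_add) op_mod \<Rightarrow> ('w, 'y::ab_group_add) op_mod \<Rightarrow> bool"
  where "A_isometric A X Y \<longleftrightarrow>
    (\<exists>T. module_map A X Y T \<and> T ` carr X = carr Y \<and> (\<forall>x\<in>carr X. norm1 Y (T x) = norm1 X x))"

definition completely_contractive ::
  "('x, 'z) op_space_scheme \<Rightarrow> ('y, 'u) op_space_scheme \<Rightarrow> ('x \<Rightarrow> 'y) \<Rightarrow> bool"
  where "completely_contractive X Y T \<longleftrightarrow>
    (\<forall>n. \<forall>x\<in>mat_over n n (carr X). mnorm Y n n (\<lambda>i j. T (x i j)) \<le> mnorm X n n x)"

text \<open>Valued in \<open>ennreal\<close>, so that it is \<open>\<infinity>\<close> for maps that are not completely bounded.\<close>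

definition cb_norm ::
  "('x, 'z) op_space_scheme \<Rightarrow> ('y, 'u) op_space_scheme \<Rightarrow> ('x \<Rightarrow> 'y) \<Rightarrow> ennreal"
  where "cb_norm X Y T =
    (SUP (n, x)\<in>{(n, x). x \<in> mat_over n n (carr X) \<and> mnorm X n n x \<le> 1}.
      ennreal (mnorm Y n n (\<lambda>i j. T (x i j))))"


section \<open>The modules \<open>R\<^sub>n(A)\<close> and the submodules of \<open>C(\<Omega>)\<close>\<close>

text \<open>
  An element of \<open>A\<^sup>(\<^sup>n\<^sup>)\<close> is a sequence that is 0 from index \<open>n\<close> on. A \<open>p \<times> q\<close> matrix over
  \<open>R\<^sub>n(A)\<close>, with each entry placed in the first row of an \<open>n \<times> n\<close> block, is a
  \<open>pn \<times> qn\<close> matrix over \<open>A\<close>.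
\<close>

definition row_module ::
  "('w::t2_space \<Rightarrow>\<^sub>C complex) set \<Rightarrow> nat \<Rightarrow> ('w, nat \<Rightarrow> ('w \<Rightarrow>\<^sub>C complex)) op_mod"
  where "row_module A n =
    \<lparr>carr = {t. (\<forall>i<n. t i \<in> A) \<and> (\<forall>i\<ge>n. t i = 0)},
     cscale = (\<lambda>c t i. const_bcontfun c * t i),
     mnorm = (\<lambda>p q x. C_mnorm (p * n) (q * n)
       (\<lambda>r s. if r mod n = 0 then x (r div n) (s div n) (s mod n) else 0)),
     act = (\<lambda>a t i. a * t i)\<rparr>"

definition function_module :: "('w::t2_space \<Rightarrow>\<^sub>C complex) set \<Rightarrow> ('w, 'w \<Rightarrow>\<^sub>C complex) op_mod"
  where "function_module M =
    \<lparr>carr = M, cscale = (\<lambda>c g. const_bcontfun c * g), mnorm = C_mnorm, act = (*)\<rparr>"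

definition closed_span ::
  "('w::t2_space \<Rightarrow>\<^sub>C complex) set \<Rightarrow> ('w \<Rightarrow>\<^sub>C complex) \<Rightarrow> ('w, 'w \<Rightarrow>\<^sub>C complex) op_mod"
  where "closed_span A f = function_module (closure ((\<lambda>a. a * f) ` A))"


section \<open>Rigged modules\<close>

definition directed_by :: "'i set \<Rightarrow> ('i \<Rightarrow> 'i \<Rightarrow> bool) \<Rightarrow> bool"
  where "directed_by D le \<longleftrightarrow>
    D \<noteq> {} \<and> (\<forall>i\<in>D. le i i) \<and>
    (\<forall>i\<in>D. \<forall>j\<in>D. \<forall>k\<in>D. le i j \<and> le j k \<longrightarrow> le i k) \<and>
    (\<forall>i\<in>D. \<forall>j\<in>D. \<exists>k\<in>D. le i k \<and> le j k)"

definition tails :: "'i set \<Rightarrow> ('i \<Rightarrow> 'i \<Rightarrow> bool) \<Rightarrow> 'i filter"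
  where "tails D le = (INF i\<in>D. principal {j\<in>D. le i j})"

definition rigging ::
  "('w::t2_space \<Rightarrow>\<^sub>C complex) set \<Rightarrow> ('w, 'x::ab_group_add) op_mod \<Rightarrow>
    'i set \<Rightarrow> ('i \<Rightarrow> 'i \<Rightarrow> bool) \<Rightarrow> ('i \<Rightarrow> nat) \<Rightarrow>
    ('i \<Rightarrow> 'x \<Rightarrow> nat \<Rightarrow> ('w \<Rightarrow>\<^sub>C complex)) \<Rightarrow> ('i \<Rightarrow> (nat \<Rightarrow> ('w \<Rightarrow>\<^sub>C complex)) \<Rightarrow> 'x) \<Rightarrow> bool"
  where "rigging A X D le n \<phi> \<psi> \<longleftrightarrow>
    directed_by D le \<and>
    (\<forall>i\<in>D. n i \<ge> 1 \<and>
      module_map A X (row_module A (n i)) (\<phi> i) \<and>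
      completely_contractive X (row_module A (n i)) (\<phi> i) \<and>
      module_map A (row_module A (n i)) X (\<psi> i) \<and>
      completely_contractive (row_module A (n i)) X (\<psi> i)) \<and>
    (\<forall>x\<in>carr X. ((\<lambda>i. norm1 X (\<psi> i (\<phi> i x) - x)) \<longlongrightarrow> 0) (tails D le)) \<and>
    (\<forall>j\<in>D. ((\<lambda>i. cb_norm X (row_module A (n j)) (\<lambda>x. \<phi> j (\<psi> i (\<phi> i x)) - \<phi> j x)) \<longlongrightarrow> 0)
      (tails D le))"

text \<open>
  The index set of a net may live on any type, but a definition can quantify only over a fixed one.
  The type \<open>rig_index\<close> is large enough: lemma \<open>rigged_if_rigging\<close> below says that a net of
  maps with index set on an arbitrary type can be replaced by one indexed by \<open>rig_index\<close>.
\<close>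

type_synonym ('w, 'x) rig_point =
  "nat \<times> ('x \<Rightarrow> nat \<Rightarrow> ('w \<Rightarrow>\<^sub>C complex)) \<times> ((nat \<Rightarrow> ('w \<Rightarrow>\<^sub>C complex)) \<Rightarrow> 'x)"

type_synonym ('w, 'x) rig_index = "('w, 'x) rig_point \<times> ('w, 'x) rig_point set"

definition rigged :: "('w::t2_space \<Rightarrow>\<^sub>C complex) set \<Rightarrow> ('w, 'x::ab_group_add) op_mod \<Rightarrow> bool"
  where "rigged A X \<longleftrightarrow>
    left_operator_module A X \<and>
    (\<exists>(D :: ('w, 'x) rig_index set) le n \<phi> \<psi>. rigging A X D le n \<phi> \<psi>)"

lemma eventually_tails:
  assumes "directed_by D le"
  shows "eventually P (tails D le) \<longleftrightarrow> (\<exists>i\<in>D. \<forall>j\<in>D. le i j \<longrightarrow> P j)"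
proof -
  have "eventually P (tails D le) \<longleftrightarrow> (\<exists>i\<in>D. eventually P (principal {j\<in>D. le i j}))"
    unfolding tails_def
  proof (rule eventually_INF_base)
    show "D \<noteq> {}"
      using assms by (simp add: directed_by_def)
    fix i j
    assume "i \<in> D" "j \<in> D"
    then obtain k where "k \<in> D" "le i k" "le j k"
      using assms unfolding directed_by_def by blast
    moreover from this have "{l\<in>D. le k l} \<subseteq> {l\<in>D. le i l} \<inter> {l\<in>D. le j l}"
      using assms \<open>i \<in> D\<close> \<open>j \<in> D\<close> unfolding directed_by_def by blast
    ultimately show "\<exists>x\<in>D. principal {j\<in>D. le x j}
        \<le> inf (principal {j\<in>D. le i j}) (principal {l\<in>D. le j l})"
      by auto
  qed
  then show ?thesis
    by (auto simp: eventually_principal)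
qed

lemma rigged_if_rigging:
  fixes X :: "('w::t2_space, 'x::ab_group_add) op_mod" and D :: "'i set"
  assumes X: "left_operator_module A X" and rig: "rigging A X D le n \<phi> \<psi>"
  shows "rigged A X"
proof -
  define t where "t i = (n i, \<phi> i, \<psi> i)" for i
  define tl where "tl k = t ` {j\<in>D. le k j}" for k
  define D' :: "('w, 'x) rig_index set" where "D' = {(t i, tl k) | i k. i \<in> D \<and> k \<in> D \<and> le k i}"
  define le' :: "('w, 'x) rig_index \<Rightarrow> ('w, 'x) rig_index \<Rightarrow> bool"
    where "le' p q \<longleftrightarrow> snd q \<subseteq> snd p" for p q
  define n' where "n' p = fst (fst p)" for p :: "('w, 'x) rig_index"
  define \<phi>' where "\<phi>' p = fst (snd (fst p))" for p :: "('w, 'x) rig_index"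
  define \<psi>' where "\<psi>' p = snd (snd (fst p))" for p :: "('w, 'x) rig_index"
  have dir: "directed_by D le"
    using rig by (simp add: rigging_def)
  have tl_mono: "tl l \<subseteq> tl k" if "k \<in> D" "l \<in> D" "le k l" for k l
    using dir that unfolding tl_def directed_by_def by blast
  have D'E: "\<exists>i\<in>D. n' p = n i \<and> \<phi>' p = \<phi> i \<and> \<psi>' p = \<psi> i" if "p \<in> D'" for p
    using that by (auto simp: D'_def n'_def \<phi>'_def \<psi>'_def t_def)
  have dir': "directed_by D' le'"
    unfolding directed_by_def
  proof (intro conjI ballI)
    obtain k where "k \<in> D" "le k k"
      using dir unfolding directed_by_def by blast
    then have "(t k, tl k) \<in> D'"
      unfolding D'_def by blast
    then show "D' \<noteq> {}"
      by blast
    fix p q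
    assume "p \<in> D'" "q \<in> D'"
    then obtain k l where kl: "k \<in> D" "l \<in> D" "snd p = tl k" "snd q = tl l"
      by (auto simp: D'_def)
    then obtain m where "m \<in> D" "le k m" "le l m" "le m m"
      using dir unfolding directed_by_def by blast
    then have "(t m, tl m) \<in> D'" "le' p (t m, tl m)" "le' q (t m, tl m)"
      using kl tl_mono[of k m] tl_mono[of l m] unfolding D'_def le'_def by (blast, simp_all)
    then show "\<exists>k\<in>D'. le' p k \<and> le' q k"
      by blast
  qed (auto simp: le'_def)
  have ev: "eventually (\<lambda>p. P (fst p)) (tails D' le')"
    if ev_t: "eventually (\<lambda>i. P (t i)) (tails D le)" for P
  proof -
    obtain k where k: "k \<in> D" "\<And>j. j \<in> D \<Longrightarrow> le k j \<Longrightarrow> P (t j)"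
      using ev_t unfolding eventually_tails[OF dir] by blast
    have "(t k, tl k) \<in> D'"
      using k(1) dir unfolding D'_def directed_by_def by blast
    moreover have "P (fst q)" if "q \<in> D'" "le' (t k, tl k) q" for q
    proof -
      have "fst q \<in> snd q"
        using that(1) unfolding D'_def tl_def by fastforce
      then have "fst q \<in> tl k"
        using that(2) by (auto simp: le'_def)
      then show ?thesis
        using k(2) by (auto simp: tl_def)
    qed
    ultimately show ?thesis
      unfolding eventually_tails[OF dir'] by blast
  qed
  have lim: "((\<lambda>p. g (fst p)) \<longlongrightarrow> l) (tails D' le')"
    if "((\<lambda>i. g (t i)) \<longlongrightarrow> l) (tails D le)" for g and l :: "'b::topological_space"
    using that unfolding tendsto_def by (auto intro: ev)
  have "rigging A X D' le' n' \<phi>' \<psi>'"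
    unfolding rigging_def
  proof (intro conjI)
    show "\<forall>p\<in>D'. n' p \<ge> 1 \<and>
      module_map A X (row_module A (n' p)) (\<phi>' p) \<and>
      completely_contractive X (row_module A (n' p)) (\<phi>' p) \<and>
      module_map A (row_module A (n' p)) X (\<psi>' p) \<and>
      completely_contractive (row_module A (n' p)) X (\<psi>' p)"
    proof
      fix p assume "p \<in> D'"
      then obtain i where i: "i \<in> D" "n' p = n i" "\<phi>' p = \<phi> i" "\<psi>' p = \<psi> i"
        using D'E by blast
      show "n' p \<ge> 1 \<and>
          module_map A X (row_module A (n' p)) (\<phi>' p) \<and>
          completely_contractive X (row_module A (n' p)) (\<phi>' p) \<and>
          module_map A (row_module A (n' p)) X (\<psi>' p) \<and>
          completely_contractive (row_module A (n' p)) X (\<psi>' p)"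
        using rig i(1) unfolding rigging_def i(2-4) by blast
    qed
    show "\<forall>x\<in>carr X. ((\<lambda>p. norm1 X (\<psi>' p (\<phi>' p x) - x)) \<longlongrightarrow> 0) (tails D' le')"
    proof
      fix x assume "x \<in> carr X"
      then show "((\<lambda>p. norm1 X (\<psi>' p (\<phi>' p x) - x)) \<longlongrightarrow> 0) (tails D' le')"
        using lim[of "\<lambda>s. norm1 X (snd (snd s) (fst (snd s) x) - x)" 0] rig
        by (simp add: t_def \<phi>'_def \<psi>'_def rigging_def)
    qed
    show "\<forall>q\<in>D'. ((\<lambda>p. cb_norm X (row_module A (n' q))
        (\<lambda>x. \<phi>' q (\<psi>' p (\<phi>' p x)) - \<phi>' q x)) \<longlongrightarrow> 0) (tails D' le')"
    proof
      fix q assume "q \<in> D'"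
      then obtain j where j: "j \<in> D" "n' q = n j" "\<phi>' q = \<phi> j"
        using D'E by blast
      then show "((\<lambda>p. cb_norm X (row_module A (n' q))
          (\<lambda>x. \<phi>' q (\<psi>' p (\<phi>' p x)) - \<phi>' q x)) \<longlongrightarrow> 0) (tails D' le')"
        using lim[of "\<lambda>s. cb_norm X (row_module A (n j))
            (\<lambda>x. \<phi> j (snd (snd s) (fst (snd s) x)) - \<phi> j x)" 0] rig
        unfolding j(2,3) by (simp add: t_def \<phi>'_def \<psi>'_def rigging_def)
    qed
  qed (fact dir')
  with X show ?thesis
    unfolding rigged_def by blast
qed


section \<open>The class \<open>\<R>\<^sub>E(\<Omega>)\<close>\<close>

text \<open>
  A tuple of length \<open>l\<close> is given by the first \<open>l\<close> terms of a sequence; the length may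
  depend on the position \<open>k\<close> in the sequence of tuples.
  The inequality \<open>\<parallel>K\<^sub>n(w)\<parallel>\<^sub>2 \<le> f(w)\<close> presupposes that \<open>f\<close> is real-valued.
  In \<open>ereal\<close>, \<open>inverse 0 = \<infinity>\<close>.
\<close>

definition tuple_norm :: "nat \<Rightarrow> (nat \<Rightarrow> ('w::topological_space \<Rightarrow>\<^sub>C complex)) \<Rightarrow> 'w \<Rightarrow> real"
  where "tuple_norm l H w = L2_set (\<lambda>i. cmod (H i w)) {..<l}"

definition tuple_dot ::
  "nat \<Rightarrow> (nat \<Rightarrow> ('w::topological_space \<Rightarrow>\<^sub>C complex)) \<Rightarrow> (nat \<Rightarrow> ('w \<Rightarrow>\<^sub>C complex)) \<Rightarrow> 'w \<Rightarrow> complex"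
  where "tuple_dot l H K w = (\<Sum>i<l. H i w * K i w)"

definition R_class :: "('w::t2_space \<Rightarrow>\<^sub>C complex) set \<Rightarrow> 'w set \<Rightarrow> ('w \<Rightarrow>\<^sub>C complex) set"
  where "R_class A E = {f :: 'w \<Rightarrow>\<^sub>C complex.
    (\<forall>w. f w = 0 \<longleftrightarrow> w \<in> E) \<and>
    (\<forall>w. f w \<in> \<real>) \<and>
    (\<exists>(l :: nat \<Rightarrow> nat) (H :: nat \<Rightarrow> nat \<Rightarrow> ('w \<Rightarrow>\<^sub>C complex)) K.
      (\<forall>k. l k \<ge> 1 \<and> (\<forall>i<l k. H k i \<in> A \<and> K k i \<in> A)) \<and>
      (\<forall>k w. tuple_norm (l k) (K k) w \<le> Re (f w) \<and>
        ereal (Re (f w)) \<le> inverse (ereal (tuple_norm (l k) (H k) w))) \<and>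
      (\<forall>C. compact C \<and> C \<subseteq> - E \<longrightarrow>
        uniform_limit C (\<lambda>k. tuple_dot (l k) (H k) (K k)) (\<lambda>_. 1) sequentially))}"

end

theory Submission
  imports Defs
begin

text \<open>
  If \<open>X\<close> is rigged by \<open>\<phi>\<^sub>i, \<psi>\<^sub>i\<close> and generated by \<open>x\<close>, then
  \<open>K\<^sub>i = \<phi>\<^sub>i x\<close> is a tuple over \<open>A\<close>. The maps \<open>\<phi>\<^sub>j \<psi>\<^sub>i\<close> are
  pointwise contractive, so \<open>\<parallel>K\<^sub>j(w)\<parallel> \<le> \<parallel>K\<^sub>i(w)\<parallel> + \<parallel>\<psi>\<^sub>i \<phi>\<^sub>i x - x\<parallel>\<close> for all
  \<open>j\<close>. Hence \<open>f(w) = sup\<^sub>i \<parallel>K\<^sub>i(w)\<parallel>\<close> is a uniform limit of continuous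
  functions, and \<open>\<parallel>a x\<parallel> = \<parallel>a f\<parallel>\<close> for \<open>a \<in> A\<close>. The tuples \<open>H\<close> come from approximating
  the images under \<open>\<psi>\<^sub>i\<close> of the standard basis by elements of \<open>A x\<close>.

  Conversely, if \<open>f\<close> is in \<open>\<R>\<^sub>E(\<Omega>)\<close>, then the closure of \<open>A f\<close> is rigged by
  \<open>g \<mapsto> g (H\<^sub>n \<cdot> K\<^sub>n) K\<^sub>n / f\<close> and \<open>t \<mapsto> (t \<cdot> H\<^sub>n) f\<close>.
\<close>


section \<open>Operator norms of complex matrices\<close>

text \<open>An abstract module has no points, so values at \<open>w\<close> are read off from rows:
  a module map between rows is multiplication by a matrix over \<open>A\<close>, and a matrix over
  \<open>A\<close> can be evaluated at \<open>w\<close>. The bound on \<open>H\<close> comes from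
  feeding \<open>\<psi> i\<close> the constant tuple conjugate to \<open>h(w)\<close>: the image has
  norm at most \<open>\<parallel>h(w)\<parallel>\<close>, while up to a small error it is
  \<open>a x\<close> with \<open>a(w) = \<parallel>h(w)\<parallel>\<^sup>2\<close>, whose norm is at
  least \<open>f(w) \<parallel>h(w)\<parallel>\<^sup>2\<close>. Condition (ii) comes from the norm
  identity: \<open>\<psi> i (\<phi> i x)\<close> close to \<open>x\<close> means that
  \<open>f (H \<cdot> K - 1)\<close> is small on all of the space, hence \<open>H \<cdot> K\<close>
  is near 1 wherever \<open>f\<close> is bounded away from 0. In the converse direction the obstacle
  is the behaviour near \<open>E\<close>. Convergence of \<open>H \<cdot> K\<close> is controlled
  only away from \<open>E\<close>, but both limits in a rigging are suprema over the whole space.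
  Each of them therefore needs a factor that vanishes on \<open>E\<close>: the function
  \<open>g\<close> itself for convergence on an element, the extra factor \<open>H \<cdot> K\<close>
  for the completely bounded norm.\<close>

definition vnorm :: "nat \<Rightarrow> (nat \<Rightarrow> complex) \<Rightarrow> real"
  where "vnorm n v = L2_set (\<lambda>i. cmod (v i)) {..<n}"

lemma vnorm_cong: "(\<And>i. i < n \<Longrightarrow> u i = v i) \<Longrightarrow> vnorm n u = vnorm n v"
  unfolding vnorm_def by (rule L2_set_cong) auto

lemma vnorm_nonneg [simp]: "0 \<le> vnorm n v"
  by (simp add: vnorm_def)

lemma vnorm_power2: "(vnorm n v)\<^sup>2 = (\<Sum>i<n. (cmod (v i))\<^sup>2)"
  by (simp add: vnorm_def L2_set_def sum_nonneg)

lemma vnorm_zero [simp]: "vnorm n (\<lambda>_. 0) = 0"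
  by (simp add: vnorm_def L2_set_0')

lemma vnorm_eq_0_iff: "vnorm n v = 0 \<longleftrightarrow> (\<forall>i<n. v i = 0)"
  by (auto simp: vnorm_def L2_set_eq_0_iff)

lemma vnorm_1 [simp]: "vnorm (Suc 0) v = cmod (v 0)"
  by (simp add: vnorm_def L2_set_def)

lemma vnorm_component: "i < n \<Longrightarrow> cmod (v i) \<le> vnorm n v"
  unfolding vnorm_def by (rule member_le_L2_set) auto

lemma vnorm_scale: "vnorm n (\<lambda>i. c * v i) = cmod c * vnorm n v"
  by (simp add: vnorm_def norm_mult L2_set_right_distrib)

lemma vnorm_le_sum: "vnorm n v \<le> (\<Sum>i<n. cmod (v i))"
  unfolding vnorm_def by (rule L2_set_le_sum) simp

lemma vnorm_mono: "(\<And>i. i < n \<Longrightarrow> cmod (u i) \<le> cmod (v i)) \<Longrightarrow> vnorm n u \<le> vnorm n v"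
  unfolding vnorm_def by (rule L2_set_mono) auto

lemma vnorm_triangle: "vnorm n (\<lambda>i. u i + v i) \<le> vnorm n u + vnorm n v"
proof -
  have "vnorm n (\<lambda>i. u i + v i) \<le> L2_set (\<lambda>i. cmod (u i) + cmod (v i)) {..<n}"
    unfolding vnorm_def by (rule L2_set_mono) (auto intro: norm_triangle_ineq)
  also have "\<dots> \<le> vnorm n u + vnorm n v"
    unfolding vnorm_def by (rule L2_set_triangle_ineq)
  finally show ?thesis .
qed

lemma vnorm_Cauchy_Schwarz: "cmod (\<Sum>i<n. u i * v i) \<le> vnorm n u * vnorm n v"
proof -
  have "cmod (\<Sum>i<n. u i * v i) \<le> (\<Sum>i<n. \<bar>cmod (u i)\<bar> * \<bar>cmod (v i)\<bar>)"
    by (rule order_trans[OF norm_sum]) (simp add: norm_mult)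
  also have "\<dots> \<le> vnorm n u * vnorm n v"
    unfolding vnorm_def by (rule L2_set_mult_ineq)
  finally show ?thesis .
qed

definition mat_vec :: "nat \<Rightarrow> (nat \<Rightarrow> nat \<Rightarrow> complex) \<Rightarrow> (nat \<Rightarrow> complex) \<Rightarrow> nat \<Rightarrow> complex"
  where "mat_vec n \<alpha> v = (\<lambda>i. \<Sum>j<n. \<alpha> i j * v j)"

lemma op_norm_altdef: "op_norm m n \<alpha> = (SUP v\<in>{v. vnorm n v \<le> 1}. vnorm m (mat_vec n \<alpha> v))"
  by (simp add: op_norm_def vnorm_def mat_vec_def)

lemma mat_vec_bound:
  assumes "vnorm n v \<le> 1"
  shows "vnorm m (mat_vec n \<alpha> v) \<le> (\<Sum>i<m. \<Sum>j<n. cmod (\<alpha> i j))"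
proof -
  have "cmod (mat_vec n \<alpha> v i) \<le> (\<Sum>j<n. cmod (\<alpha> i j))" for i
    unfolding mat_vec_def
  proof (rule order_trans[OF norm_sum], rule sum_mono)
    fix j assume "j \<in> {..<n}"
    then have "cmod (v j) \<le> 1"
      using vnorm_component[of j n v] assms by simp
    then show "cmod (\<alpha> i j * v j) \<le> cmod (\<alpha> i j)"
      by (simp add: norm_mult mult_left_le)
  qed
  then show ?thesis
    by (intro order_trans[OF vnorm_le_sum] sum_mono)
qed

lemma op_norm_bdd_above: "bdd_above ((\<lambda>v. vnorm m (mat_vec n \<alpha> v)) ` {v. vnorm n v \<le> 1})"
  using mat_vec_bound by (intro bdd_aboveI2) blast

lemma op_norm_bound: "vnorm m (mat_vec n \<alpha> v) \<le> op_norm m n \<alpha> * vnorm n v"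
proof (cases "vnorm n v = 0")
  case True
  then have "mat_vec n \<alpha> v = (\<lambda>_. 0)"
    by (auto simp: vnorm_eq_0_iff mat_vec_def intro!: ext sum.neutral)
  then show ?thesis
    using True by simp
next
  case False
  define c where "c = vnorm n v"
  have "c > 0"
    using False vnorm_nonneg[of n v] unfolding c_def by linarith
  define u where "u = (\<lambda>i. of_real (1 / c) * v i)"
  have "vnorm n u \<le> 1"
    using \<open>c > 0\<close> unfolding u_def vnorm_scale c_def[symmetric] by (simp add: norm_divide)
  then have le: "vnorm m (mat_vec n \<alpha> u) \<le> op_norm m n \<alpha>"
    unfolding op_norm_altdef by (intro cSUP_upper op_norm_bdd_above) simp
  have "mat_vec n \<alpha> u = (\<lambda>i. of_real (1 / c) * mat_vec n \<alpha> v i)"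
    by (simp add: mat_vec_def u_def sum_distrib_left mult.left_commute)
  then have "vnorm m (mat_vec n \<alpha> u) = vnorm m (mat_vec n \<alpha> v) / c"
    using \<open>c > 0\<close> unfolding \<open>mat_vec n \<alpha> u = _\<close> vnorm_scale by (simp add: norm_divide)
  with le show ?thesis
    using \<open>c > 0\<close> by (simp add: c_def[symmetric] field_simps)
qed

lemma op_norm_leI:
  assumes "\<And>v. vnorm n v \<le> 1 \<Longrightarrow> vnorm m (mat_vec n \<alpha> v) \<le> c"
  shows "op_norm m n \<alpha> \<le> c"
  unfolding op_norm_altdef
proof (rule cSUP_least)
  show "{v. vnorm n v \<le> 1} \<noteq> {}"
    using vnorm_zero[of n] by (auto intro!: exI[of _ "\<lambda>_. 0"])
qed (use assms in auto)

lemma op_norm_leI':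
  assumes "\<And>v. vnorm m (mat_vec n \<alpha> v) \<le> c * vnorm n v" and "0 \<le> c"
  shows "op_norm m n \<alpha> \<le> c"
proof (rule op_norm_leI)
  fix v assume "vnorm n v \<le> 1"
  then show "vnorm m (mat_vec n \<alpha> v) \<le> c"
    using assms(1)[of v] assms(2) mult_left_mono[of "vnorm n v" 1 c] by simp
qed

lemma op_norm_nonneg [simp]: "0 \<le> op_norm m n \<alpha>"
proof -
  have "vnorm m (mat_vec n \<alpha> (\<lambda>_. 0)) \<le> op_norm m n \<alpha>"
    unfolding op_norm_altdef by (intro cSUP_upper op_norm_bdd_above) simp
  then show ?thesis
    using vnorm_nonneg order_trans by blast
qed

lemma op_norm_le_sum: "op_norm m n \<alpha> \<le> (\<Sum>i<m. \<Sum>j<n. cmod (\<alpha> i j))"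
  by (rule op_norm_leI) (rule mat_vec_bound)

lemma op_norm_cong:
  assumes "\<And>i j. i < m \<Longrightarrow> j < n \<Longrightarrow> \<alpha> i j = \<beta> i j"
  shows "op_norm m n \<alpha> = op_norm m n \<beta>"
  unfolding op_norm_altdef using assms
  by (intro SUP_cong refl vnorm_cong) (simp add: mat_vec_def)

lemma op_norm_triangle: "op_norm m n (\<lambda>i j. \<alpha> i j + \<beta> i j) \<le> op_norm m n \<alpha> + op_norm m n \<beta>"
proof (rule op_norm_leI')
  fix v
  have "mat_vec n (\<lambda>i j. \<alpha> i j + \<beta> i j) v = (\<lambda>i. mat_vec n \<alpha> v i + mat_vec n \<beta> v i)"
    by (simp add: mat_vec_def algebra_simps sum.distrib)
  then have "vnorm m (mat_vec n (\<lambda>i j. \<alpha> i j + \<beta> i j) v)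
      \<le> vnorm m (mat_vec n \<alpha> v) + vnorm m (mat_vec n \<beta> v)"
    by (simp add: vnorm_triangle)
  then show "vnorm m (mat_vec n (\<lambda>i j. \<alpha> i j + \<beta> i j) v)
      \<le> (op_norm m n \<alpha> + op_norm m n \<beta>) * vnorm n v"
    using op_norm_bound[of m n \<alpha> v] op_norm_bound[of m n \<beta> v] by (simp add: algebra_simps)
qed simp

lemma op_norm_scale: "op_norm m n (\<lambda>i j. c * \<alpha> i j) = cmod c * op_norm m n \<alpha>"
proof -
  have eq: "vnorm m (mat_vec n (\<lambda>i j. c * \<alpha> i j) v) = cmod c * vnorm m (mat_vec n \<alpha> v)"
    for c \<alpha> v
    unfolding vnorm_scale[symmetric] by (simp add: mat_vec_def sum_distrib_left mult.assoc)
  have le: "op_norm m n (\<lambda>i j. c * \<alpha> i j) \<le> cmod c * op_norm m n \<alpha>" for c \<alpha>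
  proof (rule op_norm_leI')
    show "vnorm m (mat_vec n (\<lambda>i j. c * \<alpha> i j) v) \<le> cmod c * op_norm m n \<alpha> * vnorm n v" for v
      unfolding eq mult.assoc by (intro mult_left_mono op_norm_bound) simp
  qed simp
  show ?thesis
  proof (cases "c = 0")
    case True
    then show ?thesis
      using le[of 0 \<alpha>] op_norm_nonneg[of m n "\<lambda>_ _. 0"] by (auto intro: antisym)
  next
    case False
    have "op_norm m n \<alpha> \<le> cmod (inverse c) * op_norm m n (\<lambda>i j. c * \<alpha> i j)"
      using le[of "inverse c" "\<lambda>i j. c * \<alpha> i j"] False by (simp add: mult.assoc[symmetric])
    then have "cmod c * op_norm m n \<alpha> \<le> op_norm m n (\<lambda>i j. c * \<alpha> i j)"
      using False by (simp add: norm_divide field_simps)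
    then show ?thesis
      using le by (auto intro: antisym)
  qed
qed

lemma op_norm_mult:
  "op_norm m n (\<lambda>i j. \<Sum>k<p. \<alpha> i k * \<beta> k j) \<le> op_norm m p \<alpha> * op_norm p n \<beta>"
proof (rule op_norm_leI')
  fix v
  have "mat_vec n (\<lambda>i j. \<Sum>k<p. \<alpha> i k * \<beta> k j) v = mat_vec p \<alpha> (mat_vec n \<beta> v)"
  proof
    fix i
    have "(\<Sum>j<n. (\<Sum>k<p. \<alpha> i k * \<beta> k j) * v j) = (\<Sum>j<n. \<Sum>k<p. \<alpha> i k * \<beta> k j * v j)"
      by (simp add: sum_distrib_right)
    also have "\<dots> = (\<Sum>k<p. \<Sum>j<n. \<alpha> i k * \<beta> k j * v j)"
      by (rule sum.swap)
    finally show "mat_vec n (\<lambda>i j. \<Sum>k<p. \<alpha> i k * \<beta> k j) v i = mat_vec p \<alpha> (mat_vec n \<beta> v) i"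
      by (simp add: mat_vec_def sum_distrib_left mult.assoc)
  qed
  then have "vnorm m (mat_vec n (\<lambda>i j. \<Sum>k<p. \<alpha> i k * \<beta> k j) v)
      \<le> op_norm m p \<alpha> * vnorm p (mat_vec n \<beta> v)"
    by (simp add: op_norm_bound)
  also have "\<dots> \<le> op_norm m p \<alpha> * (op_norm p n \<beta> * vnorm n v)"
    by (intro mult_left_mono op_norm_bound) simp
  finally show "vnorm m (mat_vec n (\<lambda>i j. \<Sum>k<p. \<alpha> i k * \<beta> k j) v)
      \<le> op_norm m p \<alpha> * op_norm p n \<beta> * vnorm n v"
    by (simp add: mult.assoc)
qed simp

lemma op_norm_entry:
  assumes "i < m" "j < n"
  shows "cmod (\<alpha> i j) \<le> op_norm m n \<alpha>"
proof -
  define e where "e = (\<lambda>k. if k = j then 1 else 0 :: complex)"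
  have "vnorm n e = 1"
    using assms(2) by (simp add: vnorm_def L2_set_def e_def if_distrib[of "\<lambda>x. (cmod x)\<^sup>2"] cong: if_cong)
  moreover have "mat_vec n \<alpha> e i = \<alpha> i j"
    using assms(2) by (simp add: mat_vec_def e_def if_distrib[of "\<lambda>x. _ * x"] cong: if_cong)
  ultimately show ?thesis
    using vnorm_component[OF assms(1), of "mat_vec n \<alpha> e"] op_norm_bound[of m n \<alpha> e] by simp
qed

lemma op_norm_eq_0_iff: "op_norm m n \<alpha> = 0 \<longleftrightarrow> (\<forall>i<m. \<forall>j<n. \<alpha> i j = 0)"
proof
  assume "op_norm m n \<alpha> = 0"
  then show "\<forall>i<m. \<forall>j<n. \<alpha> i j = 0"
    using op_norm_entry[of _ m _ n \<alpha>] by fastforce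
next
  assume "\<forall>i<m. \<forall>j<n. \<alpha> i j = 0"
  then have "op_norm m n \<alpha> \<le> 0"
    by (intro order_trans[OF op_norm_le_sum]) simp
  then show "op_norm m n \<alpha> = 0"
    by (simp add: order_antisym)
qed

lemma op_norm_1_1 [simp]: "op_norm (Suc 0) (Suc 0) \<alpha> = cmod (\<alpha> 0 0)"
  using op_norm_le_sum[of "Suc 0" "Suc 0" \<alpha>] op_norm_entry[of 0 "Suc 0" 0 "Suc 0" \<alpha>] by simp

lemma sum_lessThan_add: "(\<Sum>i<m + p. f i) = (\<Sum>i<m. f i) + (\<Sum>i<p. f (m + i))"
  for f :: "nat \<Rightarrow> 'a::comm_monoid_add"
  by (induction p) (simp_all add: add.assoc)

lemma vnorm_add_power2: "(vnorm (m + p) v)\<^sup>2 = (vnorm m v)\<^sup>2 + (vnorm p (\<lambda>i. v (m + i)))\<^sup>2"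
  by (simp add: vnorm_power2 sum_lessThan_add)

text \<open>A block diagonal matrix acts independently on two orthogonal blocks of coordinates, so
  squares of Euclidean norms add up on both sides.\<close>

lemma op_norm_dsum: "op_norm (m + p) (n + q) (dsum m n \<alpha> \<beta>) = max (op_norm m n \<alpha>) (op_norm p q \<beta>)"
proof (rule antisym)
  let ?M = "max (op_norm m n \<alpha>) (op_norm p q \<beta>)"
  have mv1: "vnorm m (mat_vec (n + q) (dsum m n \<alpha> \<beta>) v) = vnorm m (mat_vec n \<alpha> v)" for v
    by (rule vnorm_cong) (simp add: mat_vec_def dsum_def sum_lessThan_add)
  have mv2: "vnorm p (\<lambda>i. mat_vec (n + q) (dsum m n \<alpha> \<beta>) v (m + i))
      = vnorm p (mat_vec q \<beta> (\<lambda>j. v (n + j)))" for v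
    by (rule vnorm_cong) (simp add: mat_vec_def dsum_def sum_lessThan_add)
  have mv: "(vnorm (m + p) (mat_vec (n + q) (dsum m n \<alpha> \<beta>) v))\<^sup>2
      = (vnorm m (mat_vec n \<alpha> v))\<^sup>2 + (vnorm p (mat_vec q \<beta> (\<lambda>j. v (n + j))))\<^sup>2" for v
    by (simp add: vnorm_add_power2 mv1 mv2)
  show "op_norm (m + p) (n + q) (dsum m n \<alpha> \<beta>) \<le> ?M"
  proof (rule op_norm_leI')
    fix v
    have "vnorm m (mat_vec n \<alpha> v) \<le> ?M * vnorm n v"
      by (rule order_trans[OF op_norm_bound]) (simp add: mult_right_mono)
    moreover have "vnorm p (mat_vec q \<beta> (\<lambda>j. v (n + j))) \<le> ?M * vnorm q (\<lambda>j. v (n + j))"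
      by (rule order_trans[OF op_norm_bound]) (simp add: mult_right_mono)
    ultimately have "(vnorm (m + p) (mat_vec (n + q) (dsum m n \<alpha> \<beta>) v))\<^sup>2
        \<le> (?M * vnorm n v)\<^sup>2 + (?M * vnorm q (\<lambda>j. v (n + j)))\<^sup>2"
      unfolding mv by (intro add_mono power_mono) simp_all
    also have "\<dots> = (?M * vnorm (n + q) v)\<^sup>2"
      by (simp add: power_mult_distrib vnorm_add_power2 algebra_simps)
    finally show "vnorm (m + p) (mat_vec (n + q) (dsum m n \<alpha> \<beta>) v) \<le> ?M * vnorm (n + q) v"
      by (rule power2_le_imp_le) (simp add: le_max_iff_disj)
  qed (simp add: le_max_iff_disj)
  show "?M \<le> op_norm (m + p) (n + q) (dsum m n \<alpha> \<beta>)"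
  proof (rule max.boundedI; rule op_norm_leI')
    fix v
    \<comment> \<open>Padding by zeros keeps the length of the vector and isolates the upper block;
      the lower block is isolated in the same way below.\<close>
    let ?u = "\<lambda>j::nat. if j < n then v j else (0::complex)"
    have "(vnorm (n + q) ?u)\<^sup>2 = (vnorm n v)\<^sup>2"
      unfolding vnorm_power2 sum_lessThan_add by simp
    then have u: "vnorm (n + q) ?u = vnorm n v"
      by (rule power2_eq_imp_eq) simp_all
    have "vnorm m (mat_vec n \<alpha> v) = vnorm m (mat_vec n \<alpha> ?u)"
      by (rule vnorm_cong) (simp add: mat_vec_def)
    also have "(vnorm m (mat_vec n \<alpha> ?u))\<^sup>2 \<le> (vnorm (m + p) (mat_vec (n + q) (dsum m n \<alpha> \<beta>) ?u))\<^sup>2"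
      unfolding mv by simp
    then have "vnorm m (mat_vec n \<alpha> ?u) \<le> vnorm (m + p) (mat_vec (n + q) (dsum m n \<alpha> \<beta>) ?u)"
      by (rule power2_le_imp_le) simp
    also have "\<dots> \<le> op_norm (m + p) (n + q) (dsum m n \<alpha> \<beta>) * vnorm n v"
      using op_norm_bound[of "m + p" "n + q" "dsum m n \<alpha> \<beta>" ?u] unfolding u .
    finally show "vnorm m (mat_vec n \<alpha> v) \<le> op_norm (m + p) (n + q) (dsum m n \<alpha> \<beta>) * vnorm n v" .
  next
    fix v
    let ?u = "\<lambda>j::nat. if j < n then (0::complex) else v (j - n)"
    have "(vnorm (n + q) ?u)\<^sup>2 = (vnorm q v)\<^sup>2"
      unfolding vnorm_power2 sum_lessThan_add by simp
    then have u: "vnorm (n + q) ?u = vnorm q v"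
      by (rule power2_eq_imp_eq) simp_all
    have "vnorm p (mat_vec q \<beta> v) = vnorm p (mat_vec q \<beta> (\<lambda>j. ?u (n + j)))"
      by simp
    also have "(vnorm p (mat_vec q \<beta> (\<lambda>j. ?u (n + j))))\<^sup>2
        \<le> (vnorm (m + p) (mat_vec (n + q) (dsum m n \<alpha> \<beta>) ?u))\<^sup>2"
      unfolding mv by simp
    then have "vnorm p (mat_vec q \<beta> (\<lambda>j. ?u (n + j)))
        \<le> vnorm (m + p) (mat_vec (n + q) (dsum m n \<alpha> \<beta>) ?u)"
      by (rule power2_le_imp_le) simp
    also have "\<dots> \<le> op_norm (m + p) (n + q) (dsum m n \<alpha> \<beta>) * vnorm q v"
      using op_norm_bound[of "m + p" "n + q" "dsum m n \<alpha> \<beta>" ?u] unfolding u .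
    finally show "vnorm p (mat_vec q \<beta> v) \<le> op_norm (m + p) (n + q) (dsum m n \<alpha> \<beta>) * vnorm q v" .
  qed simp_all
qed


section \<open>Matrices of continuous functions\<close>

lemma apply_bcontfun_sum [simp]:
  fixes f :: "'i \<Rightarrow> 'w::topological_space \<Rightarrow>\<^sub>C 'b::real_normed_vector"
  shows "apply_bcontfun (\<Sum>i\<in>I. f i) w = (\<Sum>i\<in>I. f i w)"
  by (induction I rule: infinite_finite_induct) simp_all

lemma const_bcontfun_apply [simp]: "apply_bcontfun (const_bcontfun c) w = c"
  by (simp add: const_bcontfun.rep_eq)

text \<open>The library has completeness of \<open>C(\<Omega>)\<close> for metric \<open>\<Omega>\<close> only.\<close>

lemma Cauchy_bcontfun_convergent:
  fixes f :: "nat \<Rightarrow> 'w::topological_space \<Rightarrow>\<^sub>C 'b::complete_space"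
  assumes "Cauchy f"
  shows "convergent f"
proof -
  have "\<forall>e>0. \<exists>N. \<forall>m n w. N \<le> m \<and> N \<le> n \<and> True \<longrightarrow> dist (f m w) (f n w) < e"
    using assms unfolding Cauchy_def by (meson dist_fun_lt_imp_dist_val_lt)
  then obtain g where "uniform_limit UNIV f g sequentially"
    using uniformly_convergent_eq_cauchy[of "\<lambda>_. True" "\<lambda>n. apply_bcontfun (f n)"]
    unfolding uniform_limit_sequentially_iff by auto
  then show ?thesis
    by (rule uniform_limit_bcontfunE) (auto simp: convergent_def)
qed

type_synonym 'w fun_matrix = "nat \<Rightarrow> nat \<Rightarrow> ('w \<Rightarrow>\<^sub>C complex)"

lemma C_mnorm_bdd_above: "bdd_above (range (\<lambda>w. op_norm m n (\<lambda>i j. F i j w)))"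
  for F :: "'w::topological_space fun_matrix"
proof (rule bdd_aboveI2)
  show "op_norm m n (\<lambda>i j. F i j w) \<le> (\<Sum>i<m. \<Sum>j<n. norm (F i j))" for w
    by (rule order_trans[OF op_norm_le_sum]) (intro sum_mono norm_bounded)
qed

lemma op_norm_le_C_mnorm: "op_norm m n (\<lambda>i j. F i j w) \<le> C_mnorm m n F"
  for F :: "'w::topological_space fun_matrix"
  unfolding C_mnorm_def by (intro cSUP_upper C_mnorm_bdd_above) simp

lemma C_mnorm_leI: "(\<And>w. op_norm m n (\<lambda>i j. apply_bcontfun (F i j) w) \<le> c) \<Longrightarrow> C_mnorm m n F \<le> c"
  for F :: "'w::topological_space fun_matrix"
  unfolding C_mnorm_def by (rule cSUP_least) auto

lemma C_mnorm_nonneg [simp]: "0 \<le> C_mnorm m n F"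
  for F :: "'w::topological_space fun_matrix"
  using op_norm_nonneg op_norm_le_C_mnorm order_trans by blast

lemma C_mnorm_1_1 [simp]: "C_mnorm (Suc 0) (Suc 0) F = norm (F 0 0)"
  for F :: "'w::topological_space fun_matrix"
proof (rule antisym)
  show "C_mnorm (Suc 0) (Suc 0) F \<le> norm (F 0 0)"
    by (rule C_mnorm_leI) (simp add: norm_bounded)
  show "norm (F 0 0) \<le> C_mnorm (Suc 0) (Suc 0) F"
  proof (rule norm_bound)
    show "cmod (F 0 0 w) \<le> C_mnorm (Suc 0) (Suc 0) F" for w
      using op_norm_le_C_mnorm[of "Suc 0" "Suc 0" F w] by simp
  qed
qed

lemma C_mnorm_mult:
  "C_mnorm m n (\<lambda>i j. \<Sum>k<p. F i k * G k j) \<le> C_mnorm m p F * C_mnorm p n G"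
  for F G :: "'w::topological_space fun_matrix"
proof (rule C_mnorm_leI)
  fix w
  have "op_norm m n (\<lambda>i j. (\<Sum>k<p. F i k * G k j) w)
      \<le> op_norm m p (\<lambda>i k. F i k w) * op_norm p n (\<lambda>k j. G k j w)"
    using op_norm_mult[of m n "\<lambda>i k. F i k w" "\<lambda>k j. G k j w" p] by simp
  also have "\<dots> \<le> C_mnorm m p F * C_mnorm p n G"
    by (intro mult_mono op_norm_le_C_mnorm) simp_all
  finally show "op_norm m n (\<lambda>i j. (\<Sum>k<p. F i k * G k j) w) \<le> C_mnorm m p F * C_mnorm p n G" .
qed

lemma C_mnorm_const: "C_mnorm m n (\<lambda>i j. const_bcontfun (\<alpha> i j)) = op_norm m n \<alpha>"
  by (simp add: C_mnorm_def)

lemma C_mnorm_cong: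
  "(\<And>i j. i < m \<Longrightarrow> j < n \<Longrightarrow> F i j = G i j) \<Longrightarrow> C_mnorm m n F = C_mnorm m n G"
  for F G :: "'w::topological_space fun_matrix"
  unfolding C_mnorm_def by (intro SUP_cong refl op_norm_cong) simp

lemma C_mnorm_eq_0_iff: "C_mnorm m n F = 0 \<longleftrightarrow> (\<forall>i<m. \<forall>j<n. F i j = 0)"
  for F :: "'w::topological_space fun_matrix"
proof
  assume 0: "C_mnorm m n F = 0"
  have "op_norm m n (\<lambda>i j. F i j w) = 0" for w
    using op_norm_le_C_mnorm[of m n F w] 0 by (simp add: order_antisym)
  then show "\<forall>i<m. \<forall>j<n. F i j = 0"
    by (auto simp: op_norm_eq_0_iff intro!: bcontfun_eqI)
next
  assume "\<forall>i<m. \<forall>j<n. F i j = 0"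
  then have "C_mnorm m n F = C_mnorm m n (\<lambda>i j. const_bcontfun 0 :: 'w \<Rightarrow>\<^sub>C complex)"
    by (intro C_mnorm_cong bcontfun_eqI) simp
  then show "C_mnorm m n F = 0"
    unfolding C_mnorm_const by (simp add: op_norm_eq_0_iff)
qed

lemma C_mnorm_triangle: "C_mnorm m n (\<lambda>i j. F i j + G i j) \<le> C_mnorm m n F + C_mnorm m n G"
  for F G :: "'w::topological_space fun_matrix"
proof (rule C_mnorm_leI)
  fix w
  show "op_norm m n (\<lambda>i j. (F i j + G i j) w) \<le> C_mnorm m n F + C_mnorm m n G"
    using op_norm_triangle[of m n "\<lambda>i j. F i j w" "\<lambda>i j. G i j w"]
      op_norm_le_C_mnorm[of m n F w] op_norm_le_C_mnorm[of m n G w] by simp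
qed

lemma C_mnorm_scale: "C_mnorm m n (\<lambda>i j. const_bcontfun c * F i j) = cmod c * C_mnorm m n F"
  for F :: "'w::topological_space fun_matrix"
proof (cases "c = 0")
  case True
  then show ?thesis
    by (auto simp: C_mnorm_eq_0_iff intro!: bcontfun_eqI)
next
  case False
  have le: "C_mnorm m n (\<lambda>i j. const_bcontfun c * F i j) \<le> cmod c * C_mnorm m n F"
    for c and F :: "'w fun_matrix"
  proof (rule C_mnorm_leI)
    show "op_norm m n (\<lambda>i j. (const_bcontfun c * F i j) w) \<le> cmod c * C_mnorm m n F" for w
      using op_norm_le_C_mnorm[of m n F w] by (simp add: op_norm_scale mult_left_mono)
  qed
  have "(\<lambda>i j. const_bcontfun (inverse c) * (const_bcontfun c * F i j)) = F"
    using False by (intro ext bcontfun_eqI) simp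
  then have "C_mnorm m n F \<le> cmod (inverse c) * C_mnorm m n (\<lambda>i j. const_bcontfun c * F i j)"
    using le[of "inverse c" "\<lambda>i j. const_bcontfun c * F i j"] by simp
  then have "cmod c * C_mnorm m n F \<le> C_mnorm m n (\<lambda>i j. const_bcontfun c * F i j)"
    using False by (simp add: norm_divide field_simps)
  then show ?thesis
    using le[of c F] by simp
qed

lemma C_mnorm_dsum:
  "C_mnorm (m + p) (n + q) (dsum m n F G) = max (C_mnorm m n F) (C_mnorm p q G)"
  for F G :: "'w::topological_space fun_matrix"
proof -
  have "(\<lambda>i j. dsum m n F G i j w) = dsum m n (\<lambda>i j. F i j w) (\<lambda>i j. G i j w)" for w
    by (intro ext) (simp add: dsum_def)
  then have eq: "op_norm (m + p) (n + q) (\<lambda>i j. dsum m n F G i j w)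
      = max (op_norm m n (\<lambda>i j. F i j w)) (op_norm p q (\<lambda>i j. G i j w))" for w
    by (simp only: op_norm_dsum)
  show ?thesis
  proof (rule antisym)
    show "C_mnorm (m + p) (n + q) (dsum m n F G) \<le> max (C_mnorm m n F) (C_mnorm p q G)"
      by (rule C_mnorm_leI, unfold eq) (intro max.mono op_norm_le_C_mnorm)
    show "max (C_mnorm m n F) (C_mnorm p q G) \<le> C_mnorm (m + p) (n + q) (dsum m n F G)"
      using op_norm_le_C_mnorm[of "m + p" "n + q" "dsum m n F G", unfolded eq]
      by (intro max.boundedI C_mnorm_leI) simp_all
  qed
qed

text \<open>The double sum is the matrix product of \<open>\<alpha>\<close>, \<open>F\<close> and
  \<open>\<beta>\<close>, with the scalar matrices read as matrices of constant functions; two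
  applications of submultiplicativity suffice.\<close>

lemma C_mnorm_ruan_mult:
  "C_mnorm m n (\<lambda>i j. \<Sum>k<p. \<Sum>l<q. const_bcontfun (\<alpha> i k * \<beta> l j) * F k l)
    \<le> op_norm m p \<alpha> * C_mnorm p q F * op_norm q n \<beta>"
  for F :: "'w::topological_space fun_matrix"
proof -
  have "(\<lambda>i j. \<Sum>k<p. \<Sum>l<q. const_bcontfun (\<alpha> i k * \<beta> l j) * F k l)
    = (\<lambda>i j. \<Sum>k<p. const_bcontfun (\<alpha> i k) * (\<Sum>l<q. F k l * const_bcontfun (\<beta> l j)))"
    by (intro ext bcontfun_eqI) (simp add: sum_distrib_left algebra_simps)
  then have "C_mnorm m n (\<lambda>i j. \<Sum>k<p. \<Sum>l<q. const_bcontfun (\<alpha> i k * \<beta> l j) * F k l)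
      \<le> op_norm m p \<alpha> * C_mnorm p n (\<lambda>k j. \<Sum>l<q. F k l * const_bcontfun (\<beta> l j))"
    using C_mnorm_mult[of m n "\<lambda>i k. const_bcontfun (\<alpha> i k)" _ p] by (simp add: C_mnorm_const)
  also have "\<dots> \<le> op_norm m p \<alpha> * (C_mnorm p q F * op_norm q n \<beta>)"
    using C_mnorm_mult[of p n F "\<lambda>l j. const_bcontfun (\<beta> l j)" q]
    by (intro mult_left_mono) (simp_all add: C_mnorm_const)
  finally show ?thesis
    by (simp add: mult.assoc)
qed


section \<open>Submodules of \<open>C(\<Omega>)\<close>\<close>

lemma function_module_simps [simp]:
  "carr (function_module M) = M"
  "cscale (function_module M) c g = const_bcontfun c * g"
  "mnorm (function_module M) = C_mnorm"
  "act (function_module M) a g = a * g"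
  by (simp_all add: function_module_def)

lemma norm1_function_module [simp]: "norm1 (function_module M) g = norm g"
  by (simp add: norm1_def)

text \<open>The norm axioms are the \<open>C_mnorm\<close> lemmas, with \<open>C_mnorm_mult\<close>
  giving \<open>act_mnorm\<close>. Completeness passes from the space of all continuous functions to
  the closed set \<open>M\<close>.\<close>

lemma left_operator_module_function_module:
  assumes const: "\<And>c. const_bcontfun c \<in> A"
    and "closed M" "(0 :: 'w::t2_space \<Rightarrow>\<^sub>C complex) \<in> M" and add: "\<And>g h. g \<in> M \<Longrightarrow> h \<in> M \<Longrightarrow> g + h \<in> M"
    and act: "\<And>a g. a \<in> A \<Longrightarrow> g \<in> M \<Longrightarrow> a * g \<in> M"
  shows "left_operator_module A (function_module M)"
proof
  fix s :: "nat \<Rightarrow> 'w \<Rightarrow>\<^sub>C complex"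
  assume s: "\<forall>k. s k \<in> carr (function_module M)"
    and C: "\<forall>e>0. \<exists>N. \<forall>k\<ge>N. \<forall>l\<ge>N. norm1 (function_module M) (s k - s l) < e"
  have "Cauchy s"
    using C by (simp add: Cauchy_def dist_norm)
  then obtain x where x: "s \<longlonglongrightarrow> x"
    using Cauchy_bcontfun_convergent by (auto simp: convergent_def)
  then have "x \<in> M"
    using \<open>closed M\<close> s by (auto intro: closed_sequentially)
  moreover have "(\<lambda>k. norm (s k - x)) \<longlonglongrightarrow> 0"
    using x by (simp add: LIM_zero tendsto_norm_zero)
  ultimately show "\<exists>x\<in>carr (function_module M). (\<lambda>k. norm1 (function_module M) (s k - x)) \<longlonglongrightarrow> 0"
    by auto
qed (use assms C_mnorm_mult in \<open>auto simp: C_mnorm_eq_0_iff C_mnorm_triangle C_mnorm_scale C_mnorm_dsum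
  C_mnorm_ruan_mult distrib_left distrib_right mult.assoc[symmetric] intro!: C_mnorm_cong\<close>,
  auto intro!: bcontfun_eqI simp: algebra_simps)


section \<open>The modules \<open>R\<^sub>n(A)\<close>\<close>

lemma row_module_simps [simp]:
  "carr (row_module A n) = {t. (\<forall>i<n. t i \<in> A) \<and> (\<forall>i\<ge>n. t i = 0)}"
  "cscale (row_module A n) c t = (\<lambda>i. const_bcontfun c * t i)"
  "act (row_module A n) a t = (\<lambda>i. a * t i)"
  by (simp_all add: row_module_def)

lemma tuple_norm_vnorm: "tuple_norm n t w = vnorm n (\<lambda>i. t i w)"
  by (simp add: tuple_norm_def vnorm_def)

text \<open>Splits an index into quotient and remainder modulo \<open>n\<close>, which is how
  \<open>row_module\<close> addresses its blocks.\<close>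

lemma sum_blocks: "(\<Sum>r<N * n. f r) = (\<Sum>i<N. \<Sum>t<n. f (i * n + t))"
  for f :: "nat \<Rightarrow> 'a::comm_monoid_add"
proof (induction N)
  case (Suc N)
  have "Suc N * n = N * n + n"
    by simp
  then show ?case
    by (simp only: sum_lessThan_add Suc sum.lessThan_Suc)
qed simp

lemma vnorm_blocks_power2: "(vnorm (N * n) v)\<^sup>2 = (\<Sum>j<N. (vnorm n (\<lambda>s. v (j * n + s)))\<^sup>2)"
  by (simp add: vnorm_power2 sum_blocks)

text \<open>Each block of the matrix in \<open>row_module\<close> has only its first row filled, so
  the image vector vanishes at every index that is not a multiple of \<open>n\<close>. Dropping
  these coordinates leaves an \<open>N\<close> by \<open>N * n\<close> matrix.\<close>

lemma vnorm_row_matrix: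
  assumes "n \<ge> 1"
  shows "vnorm (N * n) (mat_vec (N * n)
      (\<lambda>r s. if r mod n = 0 then x (r div n) (s div n) (s mod n) else 0) v)
    = vnorm N (\<lambda>i. \<Sum>j<N. \<Sum>s<n. x i j s * v (j * n + s))" (is "vnorm _ ?u = vnorm _ ?y")
proof -
  have u: "?u (i * n + t) = (if t = 0 then ?y i else 0)" if "t < n" for i t
    using that by (simp add: mat_vec_def sum_blocks)
  have "(\<Sum>t<n. (cmod (?u (i * n + t)))\<^sup>2) = (cmod (?y i))\<^sup>2" for i
  proof -
    have "(\<Sum>t<n. (cmod (?u (i * n + t)))\<^sup>2) = (\<Sum>t<n. if t = 0 then (cmod (?y i))\<^sup>2 else 0)"
      by (rule sum.cong) (simp_all add: u)
    then show ?thesis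
      using assms by simp
  qed
  then have "(vnorm (N * n) ?u)\<^sup>2 = (vnorm N ?y)\<^sup>2"
    by (simp add: vnorm_power2 sum_blocks)
  then show ?thesis
    by (rule power2_eq_imp_eq) simp_all
qed

text \<open>Together with \<open>row_mnorm_bound\<close> this replaces the padded square blocks by
  the rows themselves: the norm is the best constant in an estimate on vectors of length
  \<open>N * n\<close>.\<close>

lemma row_mnorm_leI:
  fixes x :: "nat \<Rightarrow> nat \<Rightarrow> nat \<Rightarrow> ('w::t2_space \<Rightarrow>\<^sub>C complex)"
  assumes "n \<ge> 1" "0 \<le> c"
    and "\<And>w v. vnorm N (\<lambda>i. \<Sum>j<N. \<Sum>s<n. x i j s w * v (j * n + s)) \<le> c * vnorm (N * n) v"
  shows "mnorm (row_module A n) N N x \<le> c"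
proof -
  have "C_mnorm (N * n) (N * n) (\<lambda>r s. if r mod n = 0 then x (r div n) (s div n) (s mod n) else 0) \<le> c"
    using assms(3) vnorm_row_matrix[OF \<open>n \<ge> 1\<close>, of N "\<lambda>i j s. x i j s w" for w]
    by (intro C_mnorm_leI op_norm_leI' \<open>0 \<le> c\<close>)
      (simp add: if_distrib[of "\<lambda>f. apply_bcontfun f _"] cong: if_cong)
  then show ?thesis
    by (simp add: row_module_def)
qed

lemma row_mnorm_bound:
  fixes x :: "nat \<Rightarrow> nat \<Rightarrow> nat \<Rightarrow> ('w::t2_space \<Rightarrow>\<^sub>C complex)"
  assumes "n \<ge> 1"
  shows "vnorm N (\<lambda>i. \<Sum>j<N. \<Sum>s<n. x i j s w * v (j * n + s))
    \<le> mnorm (row_module A n) N N x * vnorm (N * n) v"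
proof -
  let ?F = "\<lambda>r s. if r mod n = 0 then x (r div n) (s div n) (s mod n) else 0"
  have "vnorm N (\<lambda>i. \<Sum>j<N. \<Sum>s<n. x i j s w * v (j * n + s))
      = vnorm (N * n) (mat_vec (N * n) (\<lambda>r s. ?F r s w) v)"
    using vnorm_row_matrix[OF assms, of N "\<lambda>i j s. x i j s w" v]
    by (simp add: if_distrib[of "\<lambda>f. apply_bcontfun f _"] cong: if_cong)
  also have "\<dots> \<le> op_norm (N * n) (N * n) (\<lambda>r s. ?F r s w) * vnorm (N * n) v"
    by (rule op_norm_bound)
  also have "\<dots> \<le> C_mnorm (N * n) (N * n) ?F * vnorm (N * n) v"
    by (intro mult_right_mono op_norm_le_C_mnorm) simp
  finally show ?thesis
    by (simp add: row_module_def)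
qed

text \<open>The test vector is the complex conjugate of the row at \<open>w\<close>, for which
  Cauchy-Schwarz is an equality. With \<open>norm1_row_leI\<close> it identifies the norm of a row
  as the supremum of its Euclidean lengths.\<close>

lemma tuple_norm_le_norm1:
  assumes "n \<ge> 1"
  shows "tuple_norm n t w \<le> norm1 (row_module A n) t"
proof -
  define v where "v = (\<lambda>i. cnj (t i w))"
  have v: "vnorm n v = tuple_norm n t w"
    by (simp add: tuple_norm_vnorm v_def vnorm_def)
  have "(\<Sum>s<n. t s w * v s) = of_real ((tuple_norm n t w)\<^sup>2)"
    unfolding tuple_norm_vnorm vnorm_power2 of_real_sum v_def complex_norm_square ..
  then have "(tuple_norm n t w)\<^sup>2 = cmod (\<Sum>s<n. t s w * v s)"
    by (simp only: norm_of_real) simp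
  also have "\<dots> \<le> norm1 (row_module A n) t * tuple_norm n t w"
    using row_mnorm_bound[OF assms, where N = 1 and v = v and x = "\<lambda>_ _. t" and w = w]
    by (simp add: norm1_def v)
  finally have "tuple_norm n t w * tuple_norm n t w \<le> norm1 (row_module A n) t * tuple_norm n t w"
    by (simp add: power2_eq_square)
  \<comment> \<open>If the tuple vanishes at \<open>w\<close>, nothing can be cancelled and this is
    the whole claim.\<close>
  moreover have "0 \<le> norm1 (row_module A n) t"
    by (simp add: norm1_def row_module_def)
  ultimately show ?thesis
    by (metis mult_right_le_imp_le order_le_less tuple_norm_vnorm vnorm_nonneg)
qed

lemma norm1_row_leI:
  assumes "n \<ge> 1" "\<And>w. tuple_norm n t w \<le> c"
  shows "norm1 (row_module A n) t \<le> c"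
  unfolding norm1_def
proof (rule row_mnorm_leI)
  show "0 \<le> c"
    using assms(2) vnorm_nonneg order_trans unfolding tuple_norm_vnorm by blast
  fix w v
  have "cmod (\<Sum>s<n. t s w * v s) \<le> tuple_norm n t w * vnorm n v"
    unfolding tuple_norm_vnorm by (rule vnorm_Cauchy_Schwarz)
  also have "\<dots> \<le> c * vnorm n v"
    by (intro mult_right_mono assms) simp
  finally show "vnorm 1 (\<lambda>i. \<Sum>j<1. \<Sum>s<n. t s w * v (j * n + s)) \<le> c * vnorm (1 * n) v"
    by simp
qed fact

lemma row_mnorm_mult_le:
  fixes x :: "nat \<Rightarrow> nat \<Rightarrow> nat \<Rightarrow> ('w::t2_space \<Rightarrow>\<^sub>C complex)"
    and g :: "'w fun_matrix"
  assumes "n \<ge> 1" "0 \<le> c" and \<kappa>: "\<And>w. vnorm n (\<lambda>s. \<kappa> s w) \<le> c"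
    and x: "\<And>i j s w. i < N \<Longrightarrow> j < N \<Longrightarrow> s < n \<Longrightarrow> apply_bcontfun (x i j s) w = g i j w * \<kappa> s w"
  shows "mnorm (row_module A n) N N x \<le> c * C_mnorm N N g"
proof (rule row_mnorm_leI)
  fix w v
  let ?u = "\<lambda>j. \<Sum>s<n. \<kappa> s w * v (j * n + s)"
  have "(cmod (?u j))\<^sup>2 \<le> (c * vnorm n (\<lambda>s. v (j * n + s)))\<^sup>2" for j
    by (intro power_mono order_trans[OF vnorm_Cauchy_Schwarz] mult_right_mono \<kappa>) simp_all
  then have "(vnorm N ?u)\<^sup>2 \<le> (\<Sum>j<N. (c * vnorm n (\<lambda>s. v (j * n + s)))\<^sup>2)"
    unfolding vnorm_power2[of N] by (rule sum_mono)
  also have "\<dots> = (c * vnorm (N * n) v)\<^sup>2"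
    by (simp add: power_mult_distrib vnorm_blocks_power2 sum_distrib_left)
  finally have u: "vnorm N ?u \<le> c * vnorm (N * n) v"
    by (rule power2_le_imp_le) (simp add: \<open>0 \<le> c\<close>)
  have "vnorm N (\<lambda>i. \<Sum>j<N. \<Sum>s<n. x i j s w * v (j * n + s)) = vnorm N (mat_vec N (\<lambda>i j. g i j w) ?u)"
    by (rule vnorm_cong) (simp add: mat_vec_def x sum_distrib_left mult.assoc)
  also have "\<dots> \<le> op_norm N N (\<lambda>i j. g i j w) * vnorm N ?u"
    by (rule op_norm_bound)
  also have "\<dots> \<le> C_mnorm N N g * (c * vnorm (N * n) v)"
    by (intro mult_mono op_norm_le_C_mnorm u) simp_all
  finally show "vnorm N (\<lambda>i. \<Sum>j<N. \<Sum>s<n. x i j s w * v (j * n + s)) \<le> c * C_mnorm N N g * vnorm (N * n) v"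
    by (simp add: mult_ac)
qed (use assms in auto)

text \<open>The counterpart for columns: \<open>g\<close> is \<open>x\<close> times \<open>N\<close>
  diagonal copies of the column \<open>\<eta>\<close>, and these copies form a contraction from
  vectors of length \<open>N\<close> to vectors of length \<open>N * n\<close>.\<close>

lemma C_mnorm_row_dot_le:
  fixes x :: "nat \<Rightarrow> nat \<Rightarrow> nat \<Rightarrow> ('w::t2_space \<Rightarrow>\<^sub>C complex)"
    and g :: "'w fun_matrix"
  assumes "n \<ge> 1" and \<eta>: "\<And>w. vnorm n (\<lambda>s. \<eta> s w) \<le> 1"
    and g: "\<And>i j w. i < N \<Longrightarrow> j < N \<Longrightarrow> apply_bcontfun (g i j) w = (\<Sum>s<n. x i j s w * \<eta> s w)"
  shows "C_mnorm N N g \<le> mnorm (row_module A n) N N x"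
proof (intro C_mnorm_leI op_norm_leI')
  fix w v
  define u where "u = (\<lambda>r. \<eta> (r mod n) w * v (r div n))"
  have u: "u (j * n + s) = \<eta> s w * v j" if "s < n" for j s
    using that by (simp add: u_def)
  have "vnorm n (\<lambda>s. u (j * n + s)) \<le> cmod (v j)" for j
  proof -
    have "vnorm n (\<lambda>s. u (j * n + s)) = vnorm n (\<lambda>s. v j * \<eta> s w)"
      by (rule vnorm_cong) (simp add: u)
    also have "\<dots> \<le> cmod (v j) * 1"
      unfolding vnorm_scale by (intro mult_left_mono \<eta>) simp
    finally show ?thesis
      by simp
  qed
  then have "(vnorm (N * n) u)\<^sup>2 \<le> (vnorm N v)\<^sup>2"
    unfolding vnorm_blocks_power2 vnorm_power2[of N] by (intro sum_mono power_mono) simp_all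
  then have le: "vnorm (N * n) u \<le> vnorm N v"
    by (rule power2_le_imp_le) simp
  have "vnorm N (mat_vec N (\<lambda>i j. g i j w) v) = vnorm N (\<lambda>i. \<Sum>j<N. \<Sum>s<n. x i j s w * u (j * n + s))"
    by (rule vnorm_cong) (simp add: mat_vec_def g u sum_distrib_right mult.assoc)
  also have "\<dots> \<le> mnorm (row_module A n) N N x * vnorm (N * n) u"
    by (rule row_mnorm_bound) fact
  also have "\<dots> \<le> mnorm (row_module A n) N N x * vnorm N v"
    by (intro mult_left_mono le) (simp add: row_module_def)
  finally show "vnorm N (mat_vec N (\<lambda>i j. g i j w) v) \<le> mnorm (row_module A n) N N x * vnorm N v" .
qed (simp add: row_module_def)


section \<open>Singly generated submodules of \<open>C(\<Omega>)\<close>\<close>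

lemma closure_sequenceE:
  fixes x :: "'a::metric_space"
  assumes "x \<in> closure S"
  obtains s where "\<And>k. s k \<in> S" "s \<longlonglongrightarrow> x"
  using assms unfolding closure_sequential by blast

lemma zero_in_uniform_algebra:
  assumes "uniform_algebra A"
  shows "0 \<in> A"
proof -
  have "(0 :: 'a \<Rightarrow>\<^sub>C complex) = const_bcontfun 0"
    by (rule bcontfun_eqI) simp
  then show ?thesis
    using assms unfolding uniform_algebra_def by metis
qed

lemma sum_in_uniform_algebra:
  assumes A: "uniform_algebra A" and "\<And>i. i \<in> I \<Longrightarrow> g i \<in> A"
  shows "(\<Sum>i\<in>I. g i) \<in> A"
  using assms(2)
proof (induction I rule: infinite_finite_induct)
  case (insert i I)
  then show ?case
    using A by (simp add: uniform_algebra_def)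
qed (simp_all add: zero_in_uniform_algebra[OF A])

lemma one_in_uniform_algebra: "uniform_algebra A \<Longrightarrow> 1 \<in> A"
  by (simp add: uniform_algebra_def one_bcontfun_def)

lemma carr_closed_span [simp]: "carr (closed_span A f) = closure ((\<lambda>a. a * f) ` A)"
  by (simp add: closed_span_def)

lemma left_operator_module_closed_span:
  assumes A: "uniform_algebra A"
  shows "left_operator_module A (closed_span A f)"
  unfolding closed_span_def
proof (rule left_operator_module_function_module)
  let ?M = "closure ((\<lambda>a. a * f) ` A)"
  have sub: "(\<lambda>a. a * f) ` A \<subseteq> ?M"
    by (rule closure_subset)
  show "0 \<in> ?M"
    using sub zero_in_uniform_algebra[OF A] by (force intro!: subsetD[OF sub])
  show "g + h \<in> ?M" if gh: "g \<in> ?M" "h \<in> ?M" for g h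
  proof -
    obtain s t where s: "\<And>k. s k \<in> (\<lambda>a. a * f) ` A" "s \<longlonglongrightarrow> g"
      and t: "\<And>k. t k \<in> (\<lambda>a. a * f) ` A" "t \<longlonglongrightarrow> h"
      using gh by (metis closure_sequenceE)
    have "s k + t k \<in> (\<lambda>a. a * f) ` A" for k
    proof -
      obtain a b where "a \<in> A" "b \<in> A" "s k = a * f" "t k = b * f"
        using s(1)[of k] t(1)[of k] by blast
      then have "s k + t k = (a + b) * f" "a + b \<in> A"
        using A by (simp_all add: distrib_right uniform_algebra_def)
      then show ?thesis
        by blast
    qed
    moreover have "(\<lambda>k. s k + t k) \<longlonglongrightarrow> g + h"
      by (intro tendsto_add s t)
    ultimately show ?thesis
      unfolding closure_sequential by (intro exI[of _ "\<lambda>k. s k + t k"]) blast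
  qed
  show "b * g \<in> ?M" if b: "b \<in> A" and g: "g \<in> ?M" for b g
  proof -
    obtain s where s: "\<And>k. s k \<in> (\<lambda>a. a * f) ` A" "s \<longlonglongrightarrow> g"
      using g by (metis closure_sequenceE)
    have "b * s k \<in> (\<lambda>a. a * f) ` A" for k
    proof -
      obtain a where "a \<in> A" "s k = a * f"
        using s(1)[of k] by blast
      then have "b * s k = (b * a) * f" "b * a \<in> A"
        using A b by (simp_all add: mult.assoc uniform_algebra_def)
      then show ?thesis
        by blast
    qed
    moreover have "(\<lambda>k. b * s k) \<longlonglongrightarrow> b * g"
      by (intro tendsto_mult tendsto_const s)
    ultimately show ?thesis
      unfolding closure_sequential by (intro exI[of _ "\<lambda>k. b * s k"]) blast
  qed
qed (use A in \<open>auto simp: uniform_algebra_def\<close>)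

lemma norm1_closed_span [simp]: "norm1 (closed_span A f) g = norm g"
  by (simp add: closed_span_def)

lemma act_closed_span [simp]: "act (closed_span A f) a g = a * g"
  by (simp add: closed_span_def)

lemma singly_generated_closed_span:
  assumes "uniform_algebra A"
  shows "singly_generated A (closed_span A f)"
  unfolding singly_generated_def
proof (rule bexI[of _ f], intro ballI allI impI)
  show "f \<in> carr (closed_span A f)"
    using one_in_uniform_algebra[OF assms]
    by (auto intro!: subsetD[OF closure_subset] image_eqI[of _ _ 1])
  fix y and e :: real
  assume "y \<in> carr (closed_span A f)" "e > 0"
  then obtain a where "a \<in> A" "dist (a * f) y < e"
    unfolding carr_closed_span closure_approachable by blast
  then show "\<exists>a\<in>A. norm1 (closed_span A f) (y - act (closed_span A f) a f) < e"
    by (auto simp: dist_norm norm_minus_commute)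
qed

text \<open>The junk value \<open>k w / 0 = 0\<close> is the right one here: \<open>g\<close> vanishes on the zero set of \<open>f\<close>.\<close>

lemma closed_span_mult_quotient:
  fixes f g k :: "'w::t2_space \<Rightarrow>\<^sub>C complex"
  assumes A: "uniform_algebra A" and "k \<in> A" and le: "\<And>w. cmod (k w) \<le> cmod (f w)"
    and g: "g \<in> closure ((\<lambda>a. a * f) ` A)"
  shows "\<exists>h\<in>A. \<forall>w. apply_bcontfun h w = g w * (k w / f w)"
proof -
  obtain s where s: "\<And>n. s n \<in> (\<lambda>a. a * f) ` A" "s \<longlonglongrightarrow> g"
    using g by (metis closure_sequenceE)
  then have "\<forall>n. \<exists>a\<in>A. s n = a * f"
    by blast
  then obtain a where a: "\<And>n. a n \<in> A" "\<And>n. s n = a n * f"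
    by metis
  \<comment> \<open>The coefficients \<open>a n\<close> themselves may diverge. Domination of
    \<open>k\<close> by \<open>f\<close> carries the Cauchy property from \<open>a n * f\<close>
    over to \<open>a n * k\<close>.\<close>
  have dist_le: "dist (a m * k) (a n * k) \<le> dist (s m) (s n)" for m n
  proof (rule dist_bound)
    fix w
    have "dist ((a m * k) w) ((a n * k) w) = cmod (a m w - a n w) * cmod (k w)"
      by (simp add: dist_norm norm_mult[symmetric] left_diff_distrib)
    also have "\<dots> \<le> cmod (a m w - a n w) * cmod (f w)"
      by (intro mult_left_mono le) simp
    also have "\<dots> = dist (s m w) (s n w)"
      by (simp add: dist_norm norm_mult[symmetric] left_diff_distrib a(2))
    also have "\<dots> \<le> dist (s m) (s n)"
      by (rule dist_bounded)
    finally show "dist ((a m * k) w) ((a n * k) w) \<le> dist (s m) (s n)" .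
  qed
  have "Cauchy s"
    using s(2) by (rule LIMSEQ_imp_Cauchy)
  then have "Cauchy (\<lambda>n. a n * k)"
    unfolding Cauchy_def by (meson dist_le le_less_trans)
  then obtain h where h: "(\<lambda>n. a n * k) \<longlonglongrightarrow> h"
    using Cauchy_bcontfun_convergent by (auto simp: convergent_def)
  have "a n * k \<in> A" for n
    using A a(1) \<open>k \<in> A\<close> by (simp add: uniform_algebra_def)
  then have "h \<in> A"
    using A h closed_sequentially[of A "\<lambda>n. a n * k" h] by (simp add: uniform_algebra_def)
  moreover have "h w = g w * (k w / f w)" for w
  proof -
    have lim_h: "(\<lambda>n. (a n * k) w) \<longlonglongrightarrow> h w"
      using tendsto_bcontfun_uniform_limit[OF h] by (rule tendsto_uniform_limitI) simp
    have lim_g: "(\<lambda>n. s n w) \<longlonglongrightarrow> g w"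
      using tendsto_bcontfun_uniform_limit[OF s(2)] by (rule tendsto_uniform_limitI) simp
    have "(a n * k) w = s n w * (k w / f w)" for n
      using le[of w] by (cases "f w = 0") (simp_all add: a(2))
    then have "(\<lambda>n. s n w * (k w / f w)) \<longlonglongrightarrow> h w"
      using lim_h by simp
    moreover have "(\<lambda>n. s n w * (k w / f w)) \<longlonglongrightarrow> g w * (k w / f w)"
      by (intro tendsto_mult tendsto_const lim_g)
    ultimately show ?thesis
      by (rule LIMSEQ_unique)
  qed
  ultimately show ?thesis
    by blast
qed


section \<open>The modules defined by \<open>\<R>\<^sub>E(\<Omega>)\<close> are rigged\<close>

text \<open>The product form also covers \<open>b = 0\<close>, where the inverse is
  infinite.\<close>

lemma ereal_le_inverse_iff:
  assumes "0 \<le> a" "0 \<le> b"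
  shows "ereal a \<le> inverse (ereal b) \<longleftrightarrow> a * b \<le> 1"
  using assms by (cases "b = 0") (auto simp: field_simps)

lemma directed_by_nat: "directed_by (UNIV :: nat set) (\<le>)"
  by (auto simp: directed_by_def) (metis nat_le_linear order_refl)

lemma tails_nat: "tails UNIV (\<le>) = (sequentially :: nat filter)"
  by (intro filter_eqI) (simp add: eventually_tails directed_by_nat eventually_sequentially)

text \<open>The data of the class with \<open>E\<close> recovered as the zero set of
  \<open>f\<close>, with \<open>f\<close> replaced by its modulus, and with the upper bound in
  product form so that no infinite value occurs.\<close>

locale R_class_tuples =
  fixes A :: "('w::t2_space \<Rightarrow>\<^sub>C complex) set" and f :: "'w \<Rightarrow>\<^sub>C complex"
    and l :: "nat \<Rightarrow> nat" and H K :: "nat \<Rightarrow> nat \<Rightarrow> ('w \<Rightarrow>\<^sub>C complex)"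
  assumes compact: "compact (UNIV :: 'w set)" and A: "uniform_algebra A"
    and length: "\<And>k. l k \<ge> 1"
    and H: "\<And>k i. i < l k \<Longrightarrow> H k i \<in> A" and K: "\<And>k i. i < l k \<Longrightarrow> K k i \<in> A"
    and K_le: "\<And>k w. tuple_norm (l k) (K k) w \<le> cmod (f w)"
    and H_le: "\<And>k w. cmod (f w) * tuple_norm (l k) (H k) w \<le> 1"
    and lim: "\<And>C. compact C \<Longrightarrow> (\<And>w. w \<in> C \<Longrightarrow> f w \<noteq> 0) \<Longrightarrow>
      uniform_limit C (\<lambda>k. tuple_dot (l k) (H k) (K k)) (\<lambda>_. 1) sequentially"
begin

section \<open>Pointwise estimates for the weight and for the two maps\<close>

definition q :: "nat \<Rightarrow> ('w \<Rightarrow>\<^sub>C complex)"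
  where "q k = (\<Sum>i<l k. H k i * K k i)"

text \<open>
  The tuples \<open>K\<^sub>k\<close> are replaced by \<open>(H\<^sub>k \<cdot> K\<^sub>k) K\<^sub>k\<close>. The weight
  \<open>H\<^sub>k \<cdot> K\<^sub>k\<close>, being continuous and zero on \<open>E\<close>, is small near \<open>E\<close>, which
  turns the uniform convergence on compact sets into convergence in completely bounded norm.
\<close>

definition \<kappa> :: "nat \<Rightarrow> nat \<Rightarrow> 'w \<Rightarrow> complex"
  where "\<kappa> k i w = (q k * K k i) w / f w"

text \<open>Continuity of the function under \<open>Bcontfun\<close> is supplied by
  \<open>\<phi>_apply\<close>, for \<open>g\<close> in the module only; for other \<open>g\<close>
  the value is unspecified.\<close>

definition \<phi> :: "nat \<Rightarrow> ('w \<Rightarrow>\<^sub>C complex) \<Rightarrow> nat \<Rightarrow> ('w \<Rightarrow>\<^sub>C complex)"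
  where "\<phi> k g i = (if i < l k then Bcontfun (\<lambda>w. g w * \<kappa> k i w) else 0)"

definition \<psi> :: "nat \<Rightarrow> (nat \<Rightarrow> ('w \<Rightarrow>\<^sub>C complex)) \<Rightarrow> ('w \<Rightarrow>\<^sub>C complex)"
  where "\<psi> k t = (\<Sum>s<l k. t s * H k s) * f"

lemma q_apply: "q k w = tuple_dot (l k) (H k) (K k) w"
  by (simp add: q_def tuple_dot_def)

lemma q_in_A: "q k \<in> A"
  unfolding q_def using A H K by (intro sum_in_uniform_algebra) (auto simp: uniform_algebra_def)

lemma q_eq_0: "f w = 0 \<Longrightarrow> q k w = 0"
proof -
  assume "f w = 0"
  then have "vnorm (l k) (\<lambda>i. K k i w) = 0"
    using K_le[of k w] by (simp add: tuple_norm_vnorm order_antisym)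
  then show ?thesis
    by (simp add: vnorm_eq_0_iff q_def)
qed

lemma norm_q_le_1: "cmod (q k w) \<le> 1"
proof -
  have "cmod (q k w) \<le> tuple_norm (l k) (H k) w * tuple_norm (l k) (K k) w"
    unfolding q_apply tuple_dot_def tuple_norm_vnorm by (rule vnorm_Cauchy_Schwarz)
  also have "\<dots> \<le> tuple_norm (l k) (H k) w * cmod (f w)"
    by (intro mult_left_mono K_le) (simp add: tuple_norm_vnorm)
  also have "\<dots> \<le> 1"
    using H_le[of w k] by (simp add: mult.commute)
  finally show ?thesis .
qed

lemma vnorm_\<kappa>: "vnorm (l k) (\<lambda>i. \<kappa> k i w) \<le> cmod (q k w)"
proof (cases "f w = 0")
  case True
  then show ?thesis
    by (simp add: \<kappa>_def)
next
  case False
  have "vnorm (l k) (\<lambda>i. \<kappa> k i w) = cmod (q k w) * (tuple_norm (l k) (K k) w / cmod (f w))"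
    using vnorm_scale[of "l k" "q k w / f w" "\<lambda>i. K k i w"]
    by (simp add: \<kappa>_def tuple_norm_vnorm norm_divide)
  also have "\<dots> \<le> cmod (q k w) * 1"
    using K_le[of k w] False by (intro mult_left_mono) simp_all
  finally show ?thesis
    by simp
qed

text \<open>\<open>closed_span_mult_quotient\<close> applies to \<open>q k * K k i\<close>, which is
  dominated by \<open>K k i\<close> because \<open>q k\<close> is bounded by 1, and hence by
  \<open>f\<close>.\<close>

lemma \<phi>_apply:
  assumes "g \<in> carr (closed_span A f)" "i < l k"
  shows "\<phi> k g i \<in> A" "apply_bcontfun (\<phi> k g i) w = g w * \<kappa> k i w"
proof -
  have "\<exists>h\<in>A. \<forall>w. apply_bcontfun h w = g w * ((q k * K k i) w / f w)"
  proof (rule closed_span_mult_quotient[OF A])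
    show "q k * K k i \<in> A"
      using A q_in_A K[OF assms(2)] by (simp add: uniform_algebra_def)
    show "cmod ((q k * K k i) w) \<le> cmod (f w)" for w
    proof -
      have "cmod ((q k * K k i) w) \<le> 1 * cmod (K k i w)"
        by (simp add: norm_mult mult_left_le_one_le norm_q_le_1)
      also have "\<dots> \<le> tuple_norm (l k) (K k) w"
        using vnorm_component[OF assms(2), of "\<lambda>i. K k i w"] by (simp add: tuple_norm_vnorm)
      finally show ?thesis
        using K_le[of k w] by simp
    qed
  qed (use assms in simp)
  then obtain h where h: "h \<in> A" "apply_bcontfun h = (\<lambda>w. g w * \<kappa> k i w)"
    by (auto simp: \<kappa>_def)
  then have "\<phi> k g i = h"
    using assms(2) unfolding \<phi>_def by (simp add: h(2)[symmetric] apply_bcontfun_inverse)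
  then show "\<phi> k g i \<in> A" "apply_bcontfun (\<phi> k g i) w = g w * \<kappa> k i w"
    using h by simp_all
qed

lemma \<psi>_closed:
  assumes "t \<in> carr (row_module A (l k))"
  shows "\<psi> k t \<in> carr (closed_span A f)"
proof -
  have "(\<Sum>s<l k. t s * H k s) \<in> A"
    using assms A H by (intro sum_in_uniform_algebra) (auto simp: uniform_algebra_def)
  then show ?thesis
    unfolding \<psi>_def carr_closed_span by (intro subsetD[OF closure_subset] imageI)
qed

text \<open>One factor \<open>q k w\<close> is the weight inside \<open>\<kappa>\<close>, the other
  is the dot product formed by \<open>\<psi>\<close>. Off the zero set \<open>f\<close> cancels; on
  it both sides are 0.\<close>

lemma \<psi>_\<phi>_apply:
  assumes "g \<in> carr (closed_span A f)"
  shows "\<psi> k (\<phi> k g) w = g w * (q k w)\<^sup>2"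
proof (cases "f w = 0")
  case True
  then show ?thesis
    by (simp add: \<psi>_def q_eq_0)
next
  case False
  have "\<psi> k (\<phi> k g) w = (\<Sum>s<l k. g w * \<kappa> k s w * H k s w) * f w"
    using \<phi>_apply(2)[OF assms] by (simp add: \<psi>_def)
  also have "\<dots> = g w * q k w * (\<Sum>s<l k. H k s w * K k s w)"
    unfolding sum_distrib_left sum_distrib_right
    using False by (intro sum.cong) (simp_all add: \<kappa>_def)
  finally show ?thesis
    by (simp add: q_def power2_eq_square)
qed

text \<open>Where \<open>u\<close> is small the bound 2 for the second factor is enough; the
  remaining points form a compact set on which \<open>f\<close> has no zero, so \<open>q k\<close>
  converges uniformly there. Both limits of the rigging are instances: \<open>u\<close> is an
  element of the module, or one of the weights \<open>q j\<close>.\<close>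

lemma eventually_small:
  fixes u :: "'w \<Rightarrow>\<^sub>C complex"
  assumes u: "\<And>w. f w = 0 \<Longrightarrow> u w = 0" and "e > 0"
  shows "\<forall>\<^sub>F k in sequentially. \<forall>w. cmod (u w) * cmod ((q k w)\<^sup>2 - 1) \<le> e"
proof -
  define C where "C = {w. e / 2 \<le> cmod (u w)}"
  \<comment> \<open>The summand 1 keeps \<open>N\<close> positive when \<open>u\<close> is 0. With
    \<open>d\<close> as below, the estimate on \<open>C\<close> is
    \<open>N * (d * 2) = e\<close>.\<close>
  define N where "N = norm u + 1"
  define d where "d = e / (2 * N)"
  have "N > 0"
    unfolding N_def by (rule add_nonneg_pos) simp_all
  then have "d > 0"
    using \<open>e > 0\<close> by (simp add: d_def)
  have "closed C"
    unfolding C_def by (intro closed_Collect_le continuous_intros) simp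
  then have "compact C"
    using compact_Int_closed[OF compact] by simp
  moreover have "f w \<noteq> 0" if "w \<in> C" for w
    using that u[of w] \<open>e > 0\<close> by (auto simp: C_def)
  ultimately have "\<forall>\<^sub>F k in sequentially. \<forall>w\<in>C. dist (q k w) 1 < d"
    using uniform_limitD[OF lim \<open>d > 0\<close>, of C] by (simp add: q_apply)
  then show ?thesis
  proof eventually_elim
    case (elim k)
    show ?case
    proof
      fix w
      have fac: "cmod ((q k w)\<^sup>2 - 1) = cmod (q k w - 1) * cmod (q k w + 1)"
        by (simp add: norm_mult[symmetric] power2_eq_square algebra_simps)
      have plus: "cmod (q k w + 1) \<le> 2"
        using norm_triangle_ineq[of "q k w" 1] norm_q_le_1[of k w] by simp
      have minus: "cmod (q k w - 1) \<le> 2"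
        using norm_triangle_ineq4[of "q k w" 1] norm_q_le_1[of k w] by simp
      show "cmod (u w) * cmod ((q k w)\<^sup>2 - 1) \<le> e"
      proof (cases "w \<in> C")
        case True
        then have "cmod (q k w - 1) \<le> d"
          using elim by (auto simp: dist_norm)
        then have "cmod ((q k w)\<^sup>2 - 1) \<le> d * 2"
          unfolding fac using plus \<open>d > 0\<close> by (intro mult_mono) simp_all
        then have "cmod (u w) * cmod ((q k w)\<^sup>2 - 1) \<le> N * (d * 2)"
          using norm_bounded[of u w] \<open>N > 0\<close> by (intro mult_mono) (simp_all add: N_def)
        also have "\<dots> = e"
          using \<open>N > 0\<close> by (simp add: d_def)
        finally show ?thesis .
      next
        case False
        have "cmod ((q k w)\<^sup>2 - 1) \<le> 1 * 2"
        proof -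
          have "cmod ((q k w)\<^sup>2 - 1) \<le> (cmod (q k w))\<^sup>2 + 1"
            using norm_triangle_ineq4[of "(q k w)\<^sup>2" 1] by (simp add: norm_power)
          then show ?thesis
            using power_le_one[of "cmod (q k w)" 2] norm_q_le_1[of k w] by simp
        qed
        then have "cmod (u w) * cmod ((q k w)\<^sup>2 - 1) \<le> (e / 2) * (1 * 2)"
          using False \<open>e > 0\<close> by (intro mult_mono) (simp_all add: C_def)
        then show ?thesis
          by simp
      qed
    qed
  qed
qed

section \<open>Verification of the rigging conditions\<close>

lemma module_map_\<phi>: "module_map A (closed_span A f) (row_module A (l k)) (\<phi> k)"
proof -
  interpret M: left_operator_module A "closed_span A f"
    by (rule left_operator_module_closed_span[OF A])
  have carr: "\<phi> k g \<in> carr (row_module A (l k))" if "g \<in> carr (closed_span A f)" for g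
    using \<phi>_apply(1)[OF that] by (auto simp: \<phi>_def)
  have out: "\<phi> k g i = 0" if "i \<ge> l k" for g i
    using that by (simp add: \<phi>_def)
  \<comment> \<open>Every identity required of a module map is reduced to a comparison of values,
    since \<open>\<phi>_apply\<close> describes the components by their values.\<close>
  have eqI: "\<phi> k g = t"
    if "g \<in> carr (closed_span A f)" "\<And>i. i \<ge> l k \<Longrightarrow> t i = 0"
      "\<And>i w. i < l k \<Longrightarrow> apply_bcontfun (t i) w = g w * \<kappa> k i w" for g t
  proof
    fix i
    show "\<phi> k g i = t i"
    proof (cases "i < l k")
      case True
      then show ?thesis
        by (intro bcontfun_eqI) (simp only: \<phi>_apply(2)[OF that(1)] that(3))
    next
      case False
      then show ?thesis
        by (simp only: out that(2) not_less)
    qed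
  qed
  show ?thesis
    unfolding module_map_def
  proof (intro conjI ballI allI)
    fix x y c a assume x: "x \<in> carr (closed_span A f)"
    note x_apply = \<phi>_apply(2)[OF x]
    show "\<phi> k x \<in> carr (row_module A (l k))"
      by (rule carr[OF x])
    show "\<phi> k (x + y) = \<phi> k x + \<phi> k y" if y: "y \<in> carr (closed_span A f)"
      by (rule eqI[OF M.add_closed[OF x y]])
        (simp_all add: out x_apply \<phi>_apply(2)[OF y] distrib_right)
    show "\<phi> k (cscale (closed_span A f) c x) = cscale (row_module A (l k)) c (\<phi> k x)"
      by (rule eqI[OF M.scale_closed[OF x]])
        (simp_all add: out x_apply closed_span_def)
    show "\<phi> k (act (closed_span A f) a x) = act (row_module A (l k)) a (\<phi> k x)" if "a \<in> A"
      by (rule eqI[OF M.act_closed[OF that x]])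
        (simp_all add: out x_apply)
  qed
qed

lemma module_map_\<psi>: "module_map A (row_module A (l k)) (closed_span A f) (\<psi> k)"
  unfolding module_map_def
proof (intro conjI ballI allI)
  show "\<psi> k x \<in> carr (closed_span A f)" if "x \<in> carr (row_module A (l k))" for x
    by (rule \<psi>_closed[OF that])
  show "\<psi> k (x + y) = \<psi> k x + \<psi> k y" for x y
    by (simp add: \<psi>_def distrib_right sum.distrib)
  show "\<psi> k (cscale (row_module A (l k)) c x) = cscale (closed_span A f) c (\<psi> k x)" for c x
    by (simp add: \<psi>_def closed_span_def sum_distrib_left[symmetric] mult.assoc)
  show "\<psi> k (act (row_module A (l k)) a x) = act (closed_span A f) a (\<psi> k x)" for a x
    by (simp add: \<psi>_def sum_distrib_left[symmetric] mult.assoc)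
qed

lemma completely_contractive_\<phi>:
  "completely_contractive (closed_span A f) (row_module A (l k)) (\<phi> k)"
  unfolding completely_contractive_def
proof (intro allI ballI)
  fix N x assume x: "x \<in> mat_over N N (carr (closed_span A f))"
  have "mnorm (row_module A (l k)) N N (\<lambda>i j. \<phi> k (x i j)) \<le> 1 * C_mnorm N N x"
  proof (rule row_mnorm_mult_le)
    show "vnorm (l k) (\<lambda>s. \<kappa> k s w) \<le> 1" for w
      using vnorm_\<kappa>[of k w] norm_q_le_1[of k w] by simp
    show "apply_bcontfun (\<phi> k (x i j) s) w = x i j w * \<kappa> k s w"
      if "i < N" "j < N" "s < l k" for i j s w
      using x that by (intro \<phi>_apply(2)) (auto simp: mat_over_def)
  qed (use length in simp_all)
  then show "mnorm (row_module A (l k)) N N (\<lambda>i j. \<phi> k (x i j)) \<le> mnorm (closed_span A f) N N x"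
    by (simp add: closed_span_def)
qed

lemma completely_contractive_\<psi>:
  "completely_contractive (row_module A (l k)) (closed_span A f) (\<psi> k)"
  unfolding completely_contractive_def
proof (intro allI ballI)
  fix N x assume x: "x \<in> mat_over N N (carr (row_module A (l k)))"
  have "C_mnorm N N (\<lambda>i j. \<psi> k (x i j)) \<le> mnorm (row_module A (l k)) N N x"
  proof (rule C_mnorm_row_dot_le)
    show "vnorm (l k) (\<lambda>s. f w * H k s w) \<le> 1" for w
      unfolding vnorm_scale using H_le[of w k] by (simp add: tuple_norm_vnorm)
    show "apply_bcontfun (\<psi> k (x i j)) w = (\<Sum>s<l k. x i j s w * (f w * H k s w))" for i j w
      by (simp add: \<psi>_def sum_distrib_left mult_ac)
  qed (use length in simp)
  then show "mnorm (closed_span A f) N N (\<lambda>i j. \<psi> k (x i j)) \<le> mnorm (row_module A (l k)) N N x"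
    by (simp add: closed_span_def)
qed

lemma tendsto_\<psi>_\<phi>:
  assumes g: "g \<in> carr (closed_span A f)"
  shows "(\<lambda>k. norm1 (closed_span A f) (\<psi> k (\<phi> k g) - g)) \<longlonglongrightarrow> 0"
proof (rule tendstoI)
  fix e :: real assume "e > 0"
  have "g w = 0" if "f w = 0" for w
  proof -
    obtain s where s: "\<And>n. s n \<in> (\<lambda>a. a * f) ` A" "s \<longlonglongrightarrow> g"
      using g unfolding carr_closed_span by (metis closure_sequenceE)
    have "(\<lambda>n. s n w) \<longlonglongrightarrow> g w"
      using tendsto_bcontfun_uniform_limit[OF s(2)] by (rule tendsto_uniform_limitI) simp
    moreover have "s n w = 0" for n
      using s(1)[of n] that by auto
    ultimately show ?thesis
      by (simp add: LIMSEQ_const_iff)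
  qed
  then have "\<forall>\<^sub>F k in sequentially. \<forall>w. cmod (g w) * cmod ((q k w)\<^sup>2 - 1) \<le> e / 2"
    using \<open>e > 0\<close> by (intro eventually_small) simp_all
  then show "\<forall>\<^sub>F k in sequentially. dist (norm1 (closed_span A f) (\<psi> k (\<phi> k g) - g)) 0 < e"
  proof eventually_elim
    case (elim k)
    have "norm (\<psi> k (\<phi> k g) - g) \<le> e / 2"
    proof (rule norm_bound)
      fix w
      have "(\<psi> k (\<phi> k g) - g) w = g w * ((q k w)\<^sup>2 - 1)"
        using \<psi>_\<phi>_apply[OF g] by (simp add: right_diff_distrib)
      then show "cmod ((\<psi> k (\<phi> k g) - g) w) \<le> e / 2"
        using elim by (simp add: norm_mult)
    qed
    then show ?case
      using \<open>e > 0\<close> by simp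
  qed
qed

text \<open>The difference of the two maps is multiplication by the row
  \<open>(q k\<^sup>2 - 1) \<kappa> j\<close>. By \<open>vnorm_\<kappa>\<close> its length is at
  most that of \<open>(q k\<^sup>2 - 1) q j\<close>, and \<open>q j\<close> vanishes on the zero set
  of \<open>f\<close>; the estimate is then uniform in the size of the matrix.\<close>

lemma tendsto_cb_norm:
  "(\<lambda>k. cb_norm (closed_span A f) (row_module A (l j)) (\<lambda>x. \<phi> j (\<psi> k (\<phi> k x)) - \<phi> j x)) \<longlonglongrightarrow> 0"
proof (rule order_tendstoI)
  fix a :: ennreal assume "0 < a"
  \<comment> \<open>A number strictly below \<open>a\<close> is finite even if \<open>a\<close> is
    not, and a weak bound by it yields the strict one.\<close>
  then obtain z where z: "0 < z" "z < a"
    using dense by blast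
  then obtain e where e: "z = ennreal e" "e > 0"
    by (cases z) auto
  have "\<forall>\<^sub>F k in sequentially. \<forall>w. cmod (q j w) * cmod ((q k w)\<^sup>2 - 1) \<le> e"
    using e q_eq_0 by (intro eventually_small) simp_all
  then show "\<forall>\<^sub>F k in sequentially. cb_norm (closed_span A f) (row_module A (l j))
      (\<lambda>x. \<phi> j (\<psi> k (\<phi> k x)) - \<phi> j x) < a"
  proof eventually_elim
    case (elim k)
    have "cb_norm (closed_span A f) (row_module A (l j)) (\<lambda>x. \<phi> j (\<psi> k (\<phi> k x)) - \<phi> j x) \<le> ennreal e"
      unfolding cb_norm_def
    proof (rule SUP_least, clarify, rule ennreal_leI)
      fix N :: nat and x
      assume x: "x \<in> mat_over N N (carr (closed_span A f))" and x1: "mnorm (closed_span A f) N N x \<le> 1"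
      have "mnorm (row_module A (l j)) N N (\<lambda>i i'. \<phi> j (\<psi> k (\<phi> k (x i i'))) - \<phi> j (x i i'))
          \<le> e * C_mnorm N N x"
      proof (rule row_mnorm_mult_le)
        fix w
        have "vnorm (l j) (\<lambda>s. ((q k w)\<^sup>2 - 1) * \<kappa> j s w) \<le> cmod ((q k w)\<^sup>2 - 1) * cmod (q j w)"
          unfolding vnorm_scale by (intro mult_left_mono vnorm_\<kappa>) simp
        also have "\<dots> \<le> e"
          using elim by (simp add: mult.commute)
        finally show "vnorm (l j) (\<lambda>s. ((q k w)\<^sup>2 - 1) * \<kappa> j s w) \<le> e" .
        fix i i' s assume "i < N" "i' < N" and s: "s < l j"
        then have g: "x i i' \<in> carr (closed_span A f)"
          using x by (simp add: mat_over_def)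
        then have "\<phi> k (x i i') \<in> carr (row_module A (l k))"
          using module_map_\<phi>[of k] unfolding module_map_def by blast
        then have "\<psi> k (\<phi> k (x i i')) \<in> carr (closed_span A f)"
          by (rule \<psi>_closed)
        then show "((\<phi> j (\<psi> k (\<phi> k (x i i'))) - \<phi> j (x i i')) s) w
            = x i i' w * (((q k w)\<^sup>2 - 1) * \<kappa> j s w)"
          using \<phi>_apply(2)[OF _ s] g \<psi>_\<phi>_apply[OF g]
          by (simp add: algebra_simps del: carr_closed_span)
      qed (use length e in simp_all)
      also have "\<dots> \<le> e * 1"
        using x1 e by (intro mult_left_mono) (simp_all add: closed_span_def)
      finally show "mnorm (row_module A (l j)) N N (\<lambda>i i'. \<phi> j (\<psi> k (\<phi> k (x i i'))) - \<phi> j (x i i')) \<le> e"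
        by simp
    qed
    then show ?case
      using z e by (simp add: le_less_trans)
  qed
qed simp

lemma rigged_closed_span: "rigged A (closed_span A f)"
proof (rule rigged_if_rigging)
  show "left_operator_module A (closed_span A f)"
    by (rule left_operator_module_closed_span[OF A])
  show "rigging A (closed_span A f) (UNIV :: nat set) (\<le>) l \<phi> \<psi>"
    unfolding rigging_def tails_nat
    by (intro conjI ballI directed_by_nat length module_map_\<phi> module_map_\<psi>
      completely_contractive_\<phi> completely_contractive_\<psi> tendsto_\<psi>_\<phi> tendsto_cb_norm)
qed

end

lemma rigged_closed_span_R_class:
  fixes f :: "'w::t2_space \<Rightarrow>\<^sub>C complex"
  assumes "compact (UNIV :: 'w set)" "uniform_algebra A" "f \<in> R_class A E"
  shows "rigged A (closed_span A f)"
proof -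
  obtain l H K where f: "\<forall>w. f w = 0 \<longleftrightarrow> w \<in> E" "\<forall>w. f w \<in> \<real>"
    and l: "\<forall>k. l k \<ge> 1 \<and> (\<forall>i<l k. H k i \<in> A \<and> K k i \<in> A)"
    and le: "\<forall>k w. tuple_norm (l k) (K k) w \<le> Re (f w) \<and>
        ereal (Re (f w)) \<le> inverse (ereal (tuple_norm (l k) (H k) w))"
    and lim: "\<forall>C. compact C \<and> C \<subseteq> - E \<longrightarrow>
      uniform_limit C (\<lambda>k. tuple_dot (l k) (H k) (K k)) (\<lambda>_. 1) sequentially"
    using assms(3) unfolding R_class_def mem_Collect_eq by (elim conjE exE) (rule that)
  have nonneg: "0 \<le> tuple_norm n T w" for n w and T :: "nat \<Rightarrow> 'w \<Rightarrow>\<^sub>C complex"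
    by (simp add: tuple_norm_vnorm)
  \<comment> \<open>\<open>f\<close> is real and lies above the length of a tuple, so it is
    nonnegative.\<close>
  have Re: "Re (f w) = cmod (f w)" for w
  proof -
    have "0 \<le> Re (f w)"
      using le nonneg order_trans by blast
    moreover have "f w = of_real (Re (f w))"
      using f(2) by simp
    ultimately show ?thesis
      by (metis abs_of_nonneg norm_of_real)
  qed
  interpret R_class_tuples A f l H K
  proof
    show "cmod (f w) * tuple_norm (l k) (H k) w \<le> 1" for k w
      using le ereal_le_inverse_iff[OF norm_ge_zero nonneg] unfolding Re by blast
    show "uniform_limit C (\<lambda>k. tuple_dot (l k) (H k) (K k)) (\<lambda>_. 1) sequentially"
      if "compact C" "\<And>w. w \<in> C \<Longrightarrow> f w \<noteq> 0" for C
      using that f(1) by (intro lim[rule_format]) auto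
    show "tuple_norm (l k) (K k) w \<le> cmod (f w)" for k w
      using le by (simp add: Re)
  qed (use assms l in auto)
  show ?thesis
    by (rule rigged_closed_span)
qed


section \<open>Operator modules and module maps\<close>

context left_operator_module
begin

lemma scale_zero: "x \<in> carr X \<Longrightarrow> cscale X 0 x = 0"
  using scale_add_left[of x 0 0] by simp

text \<open>Subtraction belongs to the type, closure properties to \<open>carr X\<close>; scaling by
  -1 connects the two.\<close>

lemma scale_minus_one: "x \<in> carr X \<Longrightarrow> cscale X (- 1) x = - x"
  using scale_add_left[of x "- 1" 1] scale_zero scale_one by (simp add: eq_neg_iff_add_eq_0)

lemma uminus_closed: "x \<in> carr X \<Longrightarrow> - x \<in> carr X"
  using scale_closed[of x "- 1"] by (simp add: scale_minus_one)

lemma diff_closed: "x \<in> carr X \<Longrightarrow> y \<in> carr X \<Longrightarrow> x - y \<in> carr X"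
  using add_closed[of x "- y"] uminus_closed by simp

lemma sum_closed: "(\<And>i. i \<in> I \<Longrightarrow> g i \<in> carr X) \<Longrightarrow> (\<Sum>i\<in>I. g i) \<in> carr X"
  by (induction I rule: infinite_finite_induct) (simp_all add: zero_closed add_closed)

lemma norm1_eq_0: "x \<in> carr X \<Longrightarrow> norm1 X x = 0 \<longleftrightarrow> x = 0"
  unfolding norm1_def by (subst mnorm_eq_0) (simp_all add: mat_over_def)

lemma norm1_zero: "norm1 X 0 = 0"
  using norm1_eq_0 zero_closed by blast

lemma norm1_triangle: "x \<in> carr X \<Longrightarrow> y \<in> carr X \<Longrightarrow> norm1 X (x + y) \<le> norm1 X x + norm1 X y"
  using mnorm_triangle[of "\<lambda>_ _. x" 1 1 "\<lambda>_ _. y"] by (simp add: norm1_def mat_over_def)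

lemma norm1_scale: "x \<in> carr X \<Longrightarrow> norm1 X (cscale X c x) = cmod c * norm1 X x"
  using mnorm_scale[of "\<lambda>_ _. x" 1 1 c] by (simp add: norm1_def mat_over_def)

lemma norm1_uminus: "x \<in> carr X \<Longrightarrow> norm1 X (- x) = norm1 X x"
  using norm1_scale[of x "- 1"] by (simp add: scale_minus_one)

text \<open>The norm of \<open>x + (- x)\<close> is 0 and at most twice the norm of
  \<open>x\<close>.\<close>

lemma norm1_nonneg: "x \<in> carr X \<Longrightarrow> 0 \<le> norm1 X x"
  using norm1_triangle[of x "- x"] by (simp add: norm1_zero norm1_uminus uminus_closed)

lemma norm1_diff_commute: "x \<in> carr X \<Longrightarrow> y \<in> carr X \<Longrightarrow> norm1 X (x - y) = norm1 X (y - x)"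
  using norm1_uminus[of "x - y"] by (simp add: diff_closed)

lemma norm1_triangle_diff:
  assumes "x \<in> carr X" "y \<in> carr X" "z \<in> carr X"
  shows "norm1 X (x - z) \<le> norm1 X (x - y) + norm1 X (y - z)"
  using norm1_triangle[of "x - y" "y - z"] assms by (simp add: diff_closed)

lemma norm1_triangle_sub:
  assumes "x \<in> carr X" "y \<in> carr X"
  shows "norm1 X x \<le> norm1 X y + norm1 X (x - y)"
  using norm1_triangle[of y "x - y"] assms by (simp add: diff_closed)

lemma norm1_sum:
  "(\<And>i. i \<in> I \<Longrightarrow> g i \<in> carr X) \<Longrightarrow> norm1 X (\<Sum>i\<in>I. g i) \<le> (\<Sum>i\<in>I. norm1 X (g i))"
proof (induction I rule: infinite_finite_induct)
  case (insert i I)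
  then show ?case
    using norm1_triangle[of "g i" "sum g I"] by (simp add: sum_closed)
qed (simp_all add: norm1_zero)

lemma norm1_act: "a \<in> A \<Longrightarrow> x \<in> carr X \<Longrightarrow> norm1 X (act X a x) \<le> norm a * norm1 X x"
  using act_mnorm[where m = 1 and n = 1 and p = 1 and a = "\<lambda>_ _. a" and x = "\<lambda>_ _. x"]
  by (simp add: norm1_def mat_over_def)

lemma act_diff_right:
  assumes "a \<in> A" "x \<in> carr X" "y \<in> carr X"
  shows "act X a (x - y) = act X a x - act X a y"
  using act_add_right[of a "x - y" y] assms by (simp add: diff_closed eq_diff_eq)

end

lemma uminus_in_uniform_algebra:
  assumes "uniform_algebra A" "a \<in> A"
  shows "- a \<in> A"
proof -
  have "- a = const_bcontfun (- 1) * a"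
    by (rule bcontfun_eqI) simp
  then show ?thesis
    using assms by (simp add: uniform_algebra_def)
qed

lemma diff_in_uniform_algebra: "uniform_algebra A \<Longrightarrow> a \<in> A \<Longrightarrow> b \<in> A \<Longrightarrow> a - b \<in> A"
  using uminus_in_uniform_algebra[of A b] unfolding uniform_algebra_def
  by (metis diff_conv_add_uminus)

section \<open>Module maps between rows\<close>

lemma module_map_compose:
  assumes S: "module_map A X Y S" and T: "module_map A Y Z T"
  shows "module_map A X Z (\<lambda>x. T (S x))"
proof -
  have "S x \<in> carr Y" if "x \<in> carr X" for x
    using S that by (simp add: module_map_def)
  then show ?thesis
    using S T by (simp add: module_map_def)
qed

definition row_unit :: "nat \<Rightarrow> nat \<Rightarrow> ('w::t2_space \<Rightarrow>\<^sub>C complex)"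
  where "row_unit i = (\<lambda>j. if j = i then 1 else 0)"

lemma row_unit_carr: "uniform_algebra A \<Longrightarrow> i < n \<Longrightarrow> row_unit i \<in> carr (row_module A n)"
  by (simp add: row_unit_def one_in_uniform_algebra zero_in_uniform_algebra)

text \<open>Induction over the truncations of \<open>t\<close>: each step adds one coordinate, a
  multiple of a standard basis row, so additivity and linearity of \<open>T\<close> over
  \<open>A\<close> do the rest.\<close>

lemma module_map_row_expansion:
  assumes A: "uniform_algebra A" and T: "module_map A (row_module A n) Y T"
    and t: "t \<in> carr (row_module A n)"
  shows "T t = (\<Sum>i<n. act Y (t i) (T (row_unit i)))"
proof -
  have partial: "T (\<lambda>j. if j < k then t j else 0) = (\<Sum>i<k. act Y (t i) (T (row_unit i)))" if "k \<le> n" for k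
    using that
  proof (induction k)
    case 0
    have "(\<lambda>_. 0) \<in> carr (row_module A n)"
      by (simp add: zero_in_uniform_algebra[OF A])
    \<comment> \<open>The value of \<open>T\<close> at 0 is obtained from additivity applied to 0 +
      0, by cancellation in the group.\<close>
    then have "T ((\<lambda>_. 0) + (\<lambda>_. 0)) = T (\<lambda>_. 0) + T (\<lambda>_. 0)"
      using T unfolding module_map_def by blast
    moreover have "(\<lambda>_. 0) + (\<lambda>_. 0) = (\<lambda>_::nat. 0 :: 'a \<Rightarrow>\<^sub>C complex)"
      by (simp add: fun_eq_iff)
    ultimately show ?case
      by simp
  next
    case (Suc k)
    let ?r = "\<lambda>k j. if j < k then t j else 0"
    have r: "?r k \<in> carr (row_module A n)" "t k \<in> A"
      using t Suc.prems by (auto simp: zero_in_uniform_algebra[OF A])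
    have e: "row_unit k \<in> carr (row_module A n)"
      using Suc.prems by (intro row_unit_carr A) simp
    have "act (row_module A n) (t k) (row_unit k) \<in> carr (row_module A n)"
      using A e r(2) by (auto simp: uniform_algebra_def)
    then have "T (?r k + act (row_module A n) (t k) (row_unit k))
        = T (?r k) + T (act (row_module A n) (t k) (row_unit k))"
      using T r(1) unfolding module_map_def by blast
    moreover have "T (act (row_module A n) (t k) (row_unit k)) = act Y (t k) (T (row_unit k))"
      using T r(2) e unfolding module_map_def by blast
    moreover have "?r k + act (row_module A n) (t k) (row_unit k) = ?r (Suc k)"
      by (auto simp: fun_eq_iff row_unit_def less_Suc_eq)
    ultimately show ?case
      using Suc by simp
  qed
  have "(\<lambda>j. if j < n then t j else 0) = t"
    using t by (auto simp: fun_eq_iff)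
  with partial[OF order_refl] show ?thesis
    by simp
qed

lemma sum_fun_apply: "(\<Sum>i\<in>I. g i) j = (\<Sum>i\<in>I. g i j)"
  for g :: "'i \<Rightarrow> 'j \<Rightarrow> 'b::comm_monoid_add"
  by (induction I rule: infinite_finite_induct) simp_all

lemma completely_contractive_norm1:
  assumes "completely_contractive X Y T" "x \<in> carr X"
  shows "norm1 Y (T x) \<le> norm1 X x"
  unfolding norm1_def
  using assms(1)[unfolded completely_contractive_def, rule_format, of "\<lambda>_ _. x" 1] assms(2)
  by (simp add: mat_over_def)

text \<open>
  A module map between the \<open>R\<^sub>n(A)\<close> acts at the point \<open>w\<close> as a scalar matrix; testing on
  constant tuples bounds this matrix.
\<close>

lemma row_map_pointwise_contractive:
  assumes A: "uniform_algebra A" and "n \<ge> 1" "m \<ge> 1"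
    and G: "module_map A (row_module A n) (row_module A m) G"
    and contr: "\<And>t. t \<in> carr (row_module A n) \<Longrightarrow> norm1 (row_module A m) (G t) \<le> norm1 (row_module A n) t"
    and t: "t \<in> carr (row_module A n)"
  shows "tuple_norm m (G t) w \<le> tuple_norm n t w"
proof -
  \<comment> \<open>The tuple \<open>t\<close> frozen at \<open>w\<close>. Its image agrees with
    that of \<open>t\<close> at the point \<open>w\<close>, while its length is the same at all
    points, so its norm is the length of \<open>t\<close> at \<open>w\<close>.\<close>
  define c where "c = (\<lambda>i. if i < n then const_bcontfun (t i w) else 0 :: 'a \<Rightarrow>\<^sub>C complex)"
  have c: "c \<in> carr (row_module A n)"
    using A by (simp add: c_def uniform_algebra_def)
  have "G s j w = (\<Sum>i<n. s i w * G (row_unit i) j w)" if "s \<in> carr (row_module A n)" for s j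
    unfolding module_map_row_expansion[OF A G that] by (simp add: sum_fun_apply)
  then have "G t j w = G c j w" for j
    using t c by (simp add: c_def)
  then have "tuple_norm m (G t) w = tuple_norm m (G c) w"
    by (simp add: tuple_norm_def)
  also have "\<dots> \<le> norm1 (row_module A m) (G c)"
    by (rule tuple_norm_le_norm1) fact
  also have "\<dots> \<le> norm1 (row_module A n) c"
    by (rule contr[OF c])
  also have "\<dots> \<le> tuple_norm n t w"
    using \<open>n \<ge> 1\<close>
  proof (rule norm1_row_leI)
    show "tuple_norm n c w' \<le> tuple_norm n t w" for w'
      unfolding tuple_norm_vnorm by (rule vnorm_mono) (simp add: c_def)
  qed
  finally show ?thesis .
qed


section \<open>Singly generated rigged modules\<close>

text \<open>Convergence along the net enters as \<open>approx\<close>: an index for each element and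
  each accuracy.\<close>

locale singly_generated_rigged = left_operator_module A X
  for A :: "('w::t2_space \<Rightarrow>\<^sub>C complex) set" and X :: "('w, 'x::ab_group_add) op_mod" +
  fixes x0 :: 'x and D :: "'i set" and n :: "'i \<Rightarrow> nat"
    and \<phi> :: "'i \<Rightarrow> 'x \<Rightarrow> nat \<Rightarrow> ('w \<Rightarrow>\<^sub>C complex)" and \<psi> :: "'i \<Rightarrow> (nat \<Rightarrow> ('w \<Rightarrow>\<^sub>C complex)) \<Rightarrow> 'x"
  assumes A: "uniform_algebra A"
    and x0: "x0 \<in> carr X"
    and generates: "\<And>y e. y \<in> carr X \<Longrightarrow> e > 0 \<Longrightarrow> \<exists>a\<in>A. norm1 X (y - act X a x0) < e"
    and n: "\<And>i. i \<in> D \<Longrightarrow> n i \<ge> 1"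
    and \<phi>: "\<And>i. i \<in> D \<Longrightarrow> module_map A X (row_module A (n i)) (\<phi> i)"
    and \<psi>: "\<And>i. i \<in> D \<Longrightarrow> module_map A (row_module A (n i)) X (\<psi> i)"
    and \<phi>_contr: "\<And>i x. i \<in> D \<Longrightarrow> x \<in> carr X \<Longrightarrow> norm1 (row_module A (n i)) (\<phi> i x) \<le> norm1 X x"
    and \<psi>_contr: "\<And>i t. i \<in> D \<Longrightarrow> t \<in> carr (row_module A (n i)) \<Longrightarrow> norm1 X (\<psi> i t) \<le> norm1 (row_module A (n i)) t"
    and approx: "\<And>x e. x \<in> carr X \<Longrightarrow> e > 0 \<Longrightarrow> \<exists>i\<in>D. norm1 X (\<psi> i (\<phi> i x) - x) < e"
begin

lemma A_add: "a \<in> A \<Longrightarrow> b \<in> A \<Longrightarrow> a + b \<in> A"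
  and A_mult: "a \<in> A \<Longrightarrow> b \<in> A \<Longrightarrow> a * b \<in> A"
  and A_const: "const_bcontfun c \<in> A"
  using A by (simp_all add: uniform_algebra_def)

lemmas A_diff = diff_in_uniform_algebra[OF A]
lemmas A_sum = sum_in_uniform_algebra[OF A]
lemmas A_one = one_in_uniform_algebra[OF A]

lemma \<phi>_carr: "i \<in> D \<Longrightarrow> x \<in> carr X \<Longrightarrow> \<phi> i x \<in> carr (row_module A (n i))"
  using \<phi>[of i] unfolding module_map_def by blast

lemma \<psi>_carr: "i \<in> D \<Longrightarrow> t \<in> carr (row_module A (n i)) \<Longrightarrow> \<psi> i t \<in> carr X"
  using \<psi>[of i] unfolding module_map_def by blast

lemma act_diff_left:
  assumes "a \<in> A" "b \<in> A" "x \<in> carr X"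
  shows "act X (a - b) x = act X a x - act X b x"
  using act_add_left[of "a - b" b x] assms A_diff by (simp add: eq_diff_eq)

lemma act_sum_left:
  assumes "x \<in> carr X" "\<And>i. i \<in> I \<Longrightarrow> g i \<in> A"
  shows "act X (\<Sum>i\<in>I. g i) x = (\<Sum>i\<in>I. act X (g i) x)"
proof -
  have zero: "act X 0 x = 0"
    using act_diff_left[OF A_one A_one assms(1)] by simp
  show ?thesis
    using assms(2)
  proof (induction I rule: infinite_finite_induct)
    case (insert i I)
    then show ?case
      using act_add_left[of "g i" "sum g I" x] assms(1) A_sum[of I g] by simp
  qed (simp_all add: zero)
qed

section \<open>Heights of the generator and their supremum\<close>

definition height :: "'i \<Rightarrow> 'w \<Rightarrow> real"
  where "height i w = tuple_norm (n i) (\<phi> i x0) w"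

lemma height_nonneg: "0 \<le> height i w"
  by (simp add: height_def tuple_norm_vnorm)

lemma height_le:
  assumes i: "i \<in> D"
  shows "height i w \<le> norm1 X x0"
  using tuple_norm_le_norm1[OF n[OF i], of "\<phi> i x0" w A] \<phi>_contr[OF i x0]
  unfolding height_def by (rule order_trans)

lemma continuous_height: "continuous_on S (height i)"
  unfolding height_def tuple_norm_def L2_set_def by (intro continuous_intros) simp

text \<open>With \<open>y = \<psi> i (\<phi> i x0)\<close>, the row \<open>\<phi> j x0\<close> is
  \<open>\<phi> j y\<close> minus \<open>\<phi> j (y - x0)\<close>. The first is the image of
  \<open>\<phi> i x0\<close> under a pointwise contractive map of rows, the second is bounded by
  contractivity of \<open>\<phi> j\<close>. The error depends neither on \<open>j\<close> nor on
  \<open>w\<close>.\<close>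

lemma height_almost_max:
  assumes i: "i \<in> D" and j: "j \<in> D"
  shows "height j w \<le> height i w + norm1 X (\<psi> i (\<phi> i x0) - x0)"
proof -
  define y where "y = \<psi> i (\<phi> i x0)"
  have y: "y \<in> carr X"
    unfolding y_def by (intro \<psi>_carr \<phi>_carr i x0)
  have yx: "y - x0 \<in> carr X"
    by (intro diff_closed y x0)
  have "\<phi> j (y - x0 + x0) = \<phi> j (y - x0) + \<phi> j x0"
    using \<phi>[OF j] yx x0 unfolding module_map_def by blast
  then have sum: "\<phi> j (y - x0) s + \<phi> j x0 s = \<phi> j y s" for s
    by (simp add: fun_eq_iff)
  have "height j w = vnorm (n j) (\<lambda>s. \<phi> j y s w + (- 1) * \<phi> j (y - x0) s w)"
    unfolding height_def tuple_norm_vnorm by (rule vnorm_cong) (simp add: sum[symmetric])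
  also have "\<dots> \<le> tuple_norm (n j) (\<phi> j y) w + tuple_norm (n j) (\<phi> j (y - x0)) w"
    unfolding tuple_norm_vnorm by (rule order_trans[OF vnorm_triangle], unfold vnorm_scale) simp
  also have "tuple_norm (n j) (\<phi> j (y - x0)) w \<le> norm1 X (y - x0)"
    by (rule order_trans[OF tuple_norm_le_norm1[OF n[OF j]] \<phi>_contr[OF j yx]])
  also have "tuple_norm (n j) (\<phi> j y) w \<le> height i w"
  proof -
    have "tuple_norm (n j) ((\<lambda>t. \<phi> j (\<psi> i t)) (\<phi> i x0)) w \<le> tuple_norm (n i) (\<phi> i x0) w"
    proof (rule row_map_pointwise_contractive[OF A n[OF i] n[OF j]])
      show "module_map A (row_module A (n i)) (row_module A (n j)) (\<lambda>t. \<phi> j (\<psi> i t))"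
        by (rule module_map_compose[OF \<psi>[OF i] \<phi>[OF j]])
      show "norm1 (row_module A (n j)) (\<phi> j (\<psi> i t)) \<le> norm1 (row_module A (n i)) t"
        if "t \<in> carr (row_module A (n i))" for t
        using \<phi>_contr[OF j \<psi>_carr[OF i that]] \<psi>_contr[OF i that] by (rule order_trans)
    qed (rule \<phi>_carr[OF i x0])
    then show ?thesis
      by (simp add: y_def height_def)
  qed
  finally show ?thesis
    by (simp add: y_def)
qed

definition top_height :: "'w \<Rightarrow> real"
  where "top_height w = (SUP i\<in>D. height i w)"

lemma D_nonempty: "D \<noteq> {}"
  using approx[OF x0, of 1] by auto

lemma height_le_top: "i \<in> D \<Longrightarrow> height i w \<le> top_height w"
  unfolding top_height_def by (intro cSUP_upper bdd_aboveI2) (auto intro: height_le)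

lemma top_height_le: "(\<And>j. j \<in> D \<Longrightarrow> height j w \<le> c) \<Longrightarrow> top_height w \<le> c"
  unfolding top_height_def by (rule cSUP_least[OF D_nonempty])

lemma top_height_nonneg: "0 \<le> top_height w"
  using D_nonempty height_nonneg height_le_top order_trans by blast

lemma continuous_top_height: "continuous_on UNIV top_height"
proof -
  \<comment> \<open>An index with small error is almost maximal at every point at once, so a
    sequence of indices is enough for a uniform limit.\<close>
  have "\<forall>k. \<exists>i\<in>D. norm1 X (\<psi> i (\<phi> i x0) - x0) < inverse (real (Suc k))"
    using approx[OF x0] by simp
  then obtain i where i: "\<And>k. i k \<in> D" "\<And>k. norm1 X (\<psi> (i k) (\<phi> (i k) x0) - x0) < inverse (real (Suc k))"
    by metis
  have "uniform_limit UNIV (\<lambda>k. height (i k)) top_height sequentially"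
  proof (rule uniform_limitI)
    fix e :: real assume "e > 0"
    then obtain N where N: "inverse (real (Suc N)) < e"
      using reals_Archimedean by blast
    have "dist (height (i k) w) (top_height w) < e" if "k \<ge> N" for k w
    proof -
      have "inverse (real (Suc k)) \<le> inverse (real (Suc N))"
        using that by (intro le_imp_inverse_le) simp_all
      then have "norm1 X (\<psi> (i k) (\<phi> (i k) x0) - x0) < e"
        using i(2)[of k] N by linarith
      moreover have "top_height w \<le> height (i k) w + norm1 X (\<psi> (i k) (\<phi> (i k) x0) - x0)"
        by (intro top_height_le height_almost_max i)
      ultimately show ?thesis
        using height_le_top[OF i(1), of k w] by (simp add: dist_real_def)
    qed
    then show "\<forall>\<^sub>F k in sequentially. \<forall>w\<in>UNIV. dist (height (i k) w) (top_height w) < e"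
      unfolding eventually_sequentially by blast
  qed
  then show ?thesis
    by (rule uniform_limit_theorem[rotated]) (simp_all add: continuous_height)
qed

section \<open>The function \<open>f\<close> and the norm on the multiples of the generator\<close>

definition f :: "'w \<Rightarrow>\<^sub>C complex"
  where "f = Bcontfun (\<lambda>w. of_real (top_height w))"

lemma f_apply: "f w = of_real (top_height w)"
proof -
  have "(\<lambda>w. complex_of_real (top_height w)) \<in> bcontfun"
  proof (rule bcontfun_normI)
    show "continuous_on UNIV (\<lambda>w. complex_of_real (top_height w))"
      by (intro continuous_intros continuous_top_height)
    show "cmod (of_real (top_height w)) \<le> norm1 X x0" for w
      using top_height_nonneg[of w] by (simp add: top_height_le height_le)
  qed
  then show ?thesis
    by (simp add: f_def Bcontfun_inverse)
qed

lemma norm_f_apply: "cmod (f w) = top_height w"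
  using top_height_nonneg[of w] by (simp add: f_apply)

text \<open>The row \<open>\<phi> i (a x0)\<close> has length \<open>|a w|\<close> times the height
  at \<open>w\<close>. From above: \<open>a x0\<close> is nearly the image of this row under the
  contraction \<open>\<psi> i\<close>. From below: every \<open>\<phi> i\<close> is a contraction,
  and the supremum over \<open>i\<close> turns heights into \<open>f\<close>.\<close>

lemma norm1_act_x0:
  assumes a: "a \<in> A"
  shows "norm1 X (act X a x0) = norm (a * f)"
proof (rule antisym)
  have ax: "act X a x0 \<in> carr X"
    by (rule act_closed[OF a x0])
  have tuple: "tuple_norm (n i) (\<phi> i (act X a x0)) w = cmod (a w) * height i w" if i: "i \<in> D" for i w
  proof -
    have "\<phi> i (act X a x0) = (\<lambda>s. a * \<phi> i x0 s)"
      using \<phi>[OF i] a x0 unfolding module_map_def by simp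
    then show ?thesis
      by (simp add: height_def tuple_norm_vnorm vnorm_scale)
  qed
  show "norm1 X (act X a x0) \<le> norm (a * f)"
  proof (rule field_le_epsilon)
    fix e :: real assume "e > 0"
    then obtain i where i: "i \<in> D" "norm1 X (\<psi> i (\<phi> i (act X a x0)) - act X a x0) < e"
      using approx[OF ax] by blast
    have \<phi>c: "\<phi> i (act X a x0) \<in> carr (row_module A (n i))"
      by (rule \<phi>_carr[OF i(1) ax])
    have \<psi>c: "\<psi> i (\<phi> i (act X a x0)) \<in> carr X"
      by (rule \<psi>_carr[OF i(1) \<phi>c])
    have "norm1 X (act X a x0) \<le> norm1 X (\<psi> i (\<phi> i (act X a x0))) + e"
      using norm1_triangle_sub[OF ax \<psi>c] i(2) norm1_diff_commute[OF ax \<psi>c] by simp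
    also have "norm1 X (\<psi> i (\<phi> i (act X a x0))) \<le> norm1 (row_module A (n i)) (\<phi> i (act X a x0))"
      by (rule \<psi>_contr[OF i(1) \<phi>c])
    also have "\<dots> \<le> norm (a * f)"
      using n[OF i(1)]
    proof (rule norm1_row_leI)
      fix w
      have "cmod (a w) * height i w \<le> cmod ((a * f) w)"
        by (simp add: norm_mult norm_f_apply mult_left_mono height_le_top i(1))
      then show "tuple_norm (n i) (\<phi> i (act X a x0)) w \<le> norm (a * f)"
        unfolding tuple[OF i(1)] using norm_bounded order_trans by blast
    qed
    finally show "norm1 X (act X a x0) \<le> norm (a * f) + e"
      by simp
  qed
  show "norm (a * f) \<le> norm1 X (act X a x0)"
  proof (rule norm_bound)
    fix w
    have le: "cmod (a w) * height i w \<le> norm1 X (act X a x0)" if i: "i \<in> D" for i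
      unfolding tuple[OF i, symmetric]
      by (rule order_trans[OF tuple_norm_le_norm1[OF n[OF i]] \<phi>_contr[OF i ax]])
    show "cmod ((a * f) w) \<le> norm1 X (act X a x0)"
    \<comment> \<open>Dividing by \<open>|a w|\<close> makes the bound one on the heights alone, so
      the supremum can be taken.\<close>
    proof (cases "a w = 0")
      case True
      then show ?thesis
        by (simp add: norm1_nonneg[OF ax])
    next
      case False
      then have "top_height w \<le> norm1 X (act X a x0) / cmod (a w)"
        using le by (intro top_height_le) (simp add: field_simps)
      then show ?thesis
        using False by (simp add: norm_mult norm_f_apply field_simps)
    qed
  qed
qed

section \<open>Construction of the tuples\<close>

text \<open>Expansion in the standard basis turns the errors at the basis rows into an error
  proportional to the size \<open>B\<close> of the tuple. The proportionality is what allows a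
  cancellation in \<open>tuples\<close>.\<close>

lemma generator_approx:
  fixes B \<delta> :: real
  assumes i: "i \<in> D" and h: "\<And>s. s < n i \<Longrightarrow> h s \<in> A"
    and \<delta>: "\<And>s. s < n i \<Longrightarrow> norm1 X (\<psi> i (row_unit s) - act X (h s) x0) \<le> \<delta>"
    and t: "t \<in> carr (row_module A (n i))" and B: "\<And>s. s < n i \<Longrightarrow> norm (t s) \<le> B"
  shows "norm1 X (\<psi> i t - act X (\<Sum>s<n i. t s * h s) x0) \<le> real (n i) * (B * \<delta>)"
proof -
  have e: "\<psi> i (row_unit s) \<in> carr X" "act X (h s) x0 \<in> carr X" "t s \<in> A" if "s < n i" for s
    using that t by (auto intro!: \<psi>_carr[OF i] row_unit_carr[OF A] act_closed h x0 simp del: row_module_simps)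
      (auto simp: row_module_simps)
  have "\<psi> i t - act X (\<Sum>s<n i. t s * h s) x0
      = (\<Sum>s<n i. act X (t s) (\<psi> i (row_unit s))) - (\<Sum>s<n i. act X (t s * h s) x0)"
    using e h act_sum_left[OF x0, of "{..<n i}" "\<lambda>s. t s * h s"]
    by (simp add: module_map_row_expansion[OF A \<psi>[OF i] t] A_mult)
  also have "\<dots> = (\<Sum>s<n i. act X (t s) (\<psi> i (row_unit s) - act X (h s) x0))"
    unfolding sum_subtractf[symmetric] using e h
    by (intro sum.cong) (simp_all add: act_diff_right act_mult x0)
  finally have "norm1 X (\<psi> i t - act X (\<Sum>s<n i. t s * h s) x0)
      \<le> (\<Sum>s<n i. norm1 X (act X (t s) (\<psi> i (row_unit s) - act X (h s) x0)))"
    using e by (auto intro!: norm1_sum act_closed diff_closed h x0)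
  also have "\<dots> \<le> (\<Sum>s<n i. B * \<delta>)"
  proof (rule sum_mono)
    fix s assume "s \<in> {..<n i}"
    then have s: "s < n i"
      by simp
    have d: "\<psi> i (row_unit s) - act X (h s) x0 \<in> carr X"
      using e[OF s] by (simp add: diff_closed)
    have "norm1 X (act X (t s) (\<psi> i (row_unit s) - act X (h s) x0))
        \<le> norm (t s) * norm1 X (\<psi> i (row_unit s) - act X (h s) x0)"
      by (rule norm1_act[OF e(3)[OF s] d])
    also have "\<dots> \<le> B * \<delta>"
      using B[OF s] \<delta>[OF s] norm1_nonneg[OF d] norm_ge_zero[of "t s"]
      by (intro mult_mono) linarith+
    finally show "norm1 X (act X (t s) (\<psi> i (row_unit s) - act X (h s) x0)) \<le> B * \<delta>" .
  qed
  finally show ?thesis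
    by simp
qed

text \<open>The factor \<open>1 / (1 + \<epsilon>)\<close> makes up for the error of replacing \<open>\<psi> i (row_unit s)\<close> by \<open>h s \<cdot> x0\<close>.\<close>

lemma tuples:
  assumes "\<epsilon> > 0"
  shows "\<exists>l H K. l \<ge> 1 \<and> (\<forall>i<l. H i \<in> A \<and> K i \<in> A) \<and>
    (\<forall>w. tuple_norm l K w \<le> top_height w \<and> top_height w * tuple_norm l H w \<le> 1 \<and>
      top_height w * cmod (tuple_dot l H K w - 1) \<le> (2 * norm1 X x0 + 1) * \<epsilon>)"
proof -
  define c where "c = norm1 X x0"
  have "c \<ge> 0"
    unfolding c_def by (rule norm1_nonneg[OF x0])
  obtain i where i: "i \<in> D" "norm1 X (\<psi> i (\<phi> i x0) - x0) < \<epsilon>"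
    using approx[OF x0 assms] by blast
  define N where "N = n i"
  define K where "K = \<phi> i x0"
  \<comment> \<open>Compensates the factor \<open>n i\<close> in
    \<open>generator_approx\<close>.\<close>
  define \<delta> where "\<delta> = \<epsilon> / N"
  have N: "N \<ge> 1"
    unfolding N_def by (rule n[OF i(1)])
  then have "\<delta> > 0"
    using assms by (simp add: \<delta>_def)
  have K: "K \<in> carr (row_module A N)"
    unfolding K_def N_def by (rule \<phi>_carr[OF i(1) x0])
  have "\<forall>s. \<exists>h. s < N \<longrightarrow> h \<in> A \<and> norm1 X (\<psi> i (row_unit s) - act X h x0) \<le> \<delta>"
    using generates[OF \<psi>_carr[OF i(1) row_unit_carr[OF A]] \<open>\<delta> > 0\<close>] by (metis N_def less_imp_le)
  then obtain h where h: "\<And>s. s < N \<Longrightarrow> h s \<in> A"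
    "\<And>s. s < N \<Longrightarrow> norm1 X (\<psi> i (row_unit s) - act X (h s) x0) \<le> \<delta>"
    by metis
  have gen: "norm1 X (\<psi> i t - act X (\<Sum>s<N. t s * h s) x0) \<le> B * \<epsilon>"
    if "t \<in> carr (row_module A N)" "\<And>s. s < N \<Longrightarrow> norm (t s) \<le> B" for t B
    using generator_approx[OF i(1), where h = h and \<delta> = \<delta> and t = t and B = B] that h N by (simp add: N_def[symmetric] \<delta>_def)
  have th: "top_height w * tuple_norm N h w \<le> 1 + \<epsilon>" for w
  proof -
    define v where "v = tuple_norm N h w"
    \<comment> \<open>The constant tuple conjugate to \<open>h\<close> at the point
      \<open>w\<close>: it has length \<open>v\<close> everywhere, and its dot product with
      \<open>h\<close> has the value \<open>v\<^sup>2\<close> at \<open>w\<close>.\<close>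
    define t where "t = (\<lambda>s. if s < N then const_bcontfun (cnj (h s w)) else 0 :: 'w \<Rightarrow>\<^sub>C complex)"
    define a where "a = (\<Sum>s<N. t s * h s)"
    have "v \<ge> 0"
      by (simp add: v_def tuple_norm_vnorm)
    have t: "t \<in> carr (row_module A N)"
      using A_const by (simp add: t_def)
    have a: "a \<in> A"
      unfolding a_def using h A_const by (intro A_sum A_mult) (simp_all add: t_def)
    have v_t: "tuple_norm N t w' = v" for w'
      by (simp add: tuple_norm_def L2_set_def t_def v_def)
    have "a w = (\<Sum>s<N. h s w * cnj (h s w))"
      by (simp add: a_def t_def mult.commute)
    also have "\<dots> = of_real (v\<^sup>2)"
      unfolding v_def tuple_norm_vnorm vnorm_power2 of_real_sum complex_norm_square ..
    finally have aw: "cmod (a w) = v\<^sup>2"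
      by (simp only: norm_of_real) simp
    have \<psi>t: "\<psi> i t \<in> carr X"
      using t i(1) unfolding N_def by (rule \<psi>_carr[rotated])
    have ax: "act X a x0 \<in> carr X"
      by (rule act_closed[OF a x0])
    have "top_height w * v\<^sup>2 = cmod ((a * f) w)"
      by (simp add: norm_mult aw norm_f_apply mult.commute)
    also have "\<dots> \<le> norm1 X (act X a x0)"
      unfolding norm1_act_x0[OF a] by (rule norm_bounded)
    also have "\<dots> \<le> norm1 X (\<psi> i t) + norm1 X (\<psi> i t - act X a x0)"
      using norm1_triangle_sub[OF ax \<psi>t] norm1_diff_commute[OF ax \<psi>t] by simp
    also have "norm1 X (\<psi> i t) \<le> norm1 (row_module A N) t"
      using \<psi>_contr[OF i(1)] t unfolding N_def by blast
    also have "\<dots> \<le> v"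
      using N by (rule norm1_row_leI) (simp add: v_t)
    also have "norm1 X (\<psi> i t - act X a x0) \<le> v * \<epsilon>"
      unfolding a_def
    proof (rule gen[OF t], rule norm_bound)
      show "cmod (t s w') \<le> v" if "s < N" for s w'
        using vnorm_component[OF that, of "\<lambda>s. t s w'"] v_t[of w'] by (simp add: tuple_norm_vnorm)
    qed
    \<comment> \<open>The left side is quadratic in \<open>v\<close>, while both terms on the right
      are linear, including the error; so \<open>v\<close> cancels, and if it is 0 the claim is
      trivial.\<close>
    finally have "(top_height w * v) * v \<le> (1 + \<epsilon>) * v"
      by (simp add: power2_eq_square algebra_simps)
    then show ?thesis
      using \<open>v \<ge> 0\<close> assms unfolding v_def[symmetric]
      by (cases "v = 0") (auto simp: mult_le_cancel_right)
  qed
  \<comment> \<open>The unscaled dot product. It is close to 1 after multiplication by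
    \<open>f\<close>, because \<open>b x0\<close> is close to \<open>\<psi> i (\<phi> i x0)\<close>,
    which is close to \<open>x0\<close>.\<close>
  define b where "b = (\<Sum>s<N. K s * h s)"
  have b: "b \<in> A"
    unfolding b_def using h K by (intro A_sum A_mult) simp_all
  have tb: "top_height w * cmod (b w - 1) \<le> (c + 1) * \<epsilon>" for w
  proof -
    have \<psi>K: "\<psi> i K \<in> carr X"
      using K i(1) unfolding N_def by (rule \<psi>_carr[rotated])
    have bx: "act X b x0 \<in> carr X"
      by (rule act_closed[OF b x0])
    have "top_height w * cmod (b w - 1) = cmod (((b - 1) * f) w)"
      by (simp add: norm_mult norm_f_apply mult.commute)
    also have "\<dots> \<le> norm1 X (act X (b - 1) x0)"
      unfolding norm1_act_x0[OF A_diff[OF b A_one]] by (rule norm_bounded)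
    also have "act X (b - 1) x0 = act X b x0 - x0"
      by (simp add: act_diff_left b A_one x0 act_one)
    also have "norm1 X (act X b x0 - x0) \<le> norm1 X (\<psi> i K - act X b x0) + norm1 X (\<psi> i K - x0)"
      using norm1_triangle_diff[OF bx \<psi>K x0] norm1_diff_commute[OF bx \<psi>K] by simp
    also have "norm1 X (\<psi> i K - act X b x0) \<le> c * \<epsilon>"
      unfolding b_def
    proof (rule gen[OF K], rule norm_bound)
      show "cmod (K s w') \<le> c" if "s < N" for s w'
        using vnorm_component[OF that, of "\<lambda>s. K s w'"] height_le[OF i(1), of w']
        by (simp add: height_def K_def N_def c_def tuple_norm_vnorm)
    qed
    also have "norm1 X (\<psi> i K - x0) \<le> \<epsilon>"
      using i(2) by (simp add: K_def)
    finally show ?thesis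
      by (simp add: algebra_simps)
  qed
  define r where "r = 1 / (1 + \<epsilon>)"
  have r: "0 \<le> r" "r \<le> 1" "1 - r \<le> \<epsilon>"
    using assms by (simp_all add: r_def field_simps)
  define H where "H s = const_bcontfun (of_real r) * h s" for s
  have "N \<ge> 1 \<and> (\<forall>s<N. H s \<in> A \<and> K s \<in> A) \<and>
    (\<forall>w. tuple_norm N K w \<le> top_height w \<and> top_height w * tuple_norm N H w \<le> 1 \<and>
      top_height w * cmod (tuple_dot N H K w - 1) \<le> (2 * c + 1) * \<epsilon>)"
  proof (intro conjI allI impI)
    fix w
    show "H s \<in> A" if "s < N" for s
      unfolding H_def by (intro A_mult A_const h that)
    show "K s \<in> A" if "s < N" for s
      using K that by simp
    show "tuple_norm N K w \<le> top_height w"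
      using height_le_top[OF i(1), of w] by (simp add: height_def N_def K_def)
    have "tuple_norm N H w = r * tuple_norm N h w"
      using vnorm_scale[of N "of_real r" "\<lambda>s. h s w"] r(1) by (simp add: H_def tuple_norm_vnorm)
    then show "top_height w * tuple_norm N H w \<le> 1"
      using mult_left_mono[OF th[of w] r(1)] assms by (simp add: r_def algebra_simps)
    have "tuple_dot N H K w = of_real r * b w"
      by (simp add: tuple_dot_def H_def b_def sum_distrib_left mult_ac)
    then have "tuple_dot N H K w - 1 = of_real r * (b w - 1) + of_real (r - 1)"
      by (simp add: algebra_simps)
    then have "cmod (tuple_dot N H K w - 1) \<le> r * cmod (b w - 1) + (1 - r)"
      using norm_triangle_ineq[of "of_real r * (b w - 1)" "of_real (r - 1)"] r(1,2)
      by (simp add: norm_mult del: of_real_diff)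
    also have "\<dots> \<le> cmod (b w - 1) + \<epsilon>"
      using r by (intro add_mono mult_left_le_one_le) simp_all
    finally have "top_height w * cmod (tuple_dot N H K w - 1) \<le> top_height w * (cmod (b w - 1) + \<epsilon>)"
      by (rule mult_left_mono[OF _ top_height_nonneg])
    \<comment> \<open>\<open>(c + 1) * \<epsilon>\<close> is the error of \<open>b\<close>; the
      other \<open>c * \<epsilon>\<close> is the price of the scaling by \<open>r\<close>, as the
      height is at most \<open>c\<close>. Hence the constant \<open>2 * c + 1\<close>.\<close>
    also have "\<dots> \<le> (c + 1) * \<epsilon> + c * \<epsilon>"
    proof -
      have "top_height w \<le> c"
        by (simp add: c_def top_height_le height_le)
      then have "top_height w * \<epsilon> \<le> c * \<epsilon>"
        using assms by (intro mult_right_mono) simp_all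
      then show ?thesis
        unfolding distrib_left using tb[of w] by (rule add_mono[rotated])
    qed
    finally show "top_height w * cmod (tuple_dot N H K w - 1) \<le> (2 * c + 1) * \<epsilon>"
      by (simp add: algebra_simps)
  qed (fact N)
  then show ?thesis
    unfolding c_def by blast
qed

text \<open>On a nonempty compact set without zeros of \<open>f\<close>, the continuous height has a
  positive minimum \<open>c\<close>. Dividing the weighted estimate of \<open>tuples\<close> by
  \<open>c\<close> gives uniform convergence there.\<close>

lemma f_in_R_class: "f \<in> R_class A {w. f w = 0}"
proof -
  define \<epsilon> where "\<epsilon> k = inverse (real (Suc k))" for k
  define M where "M = 2 * norm1 X x0 + 1"
  have "M > 0"
    using norm1_nonneg[OF x0] by (simp add: M_def)
  have "\<forall>k. \<exists>l H K. l \<ge> 1 \<and> (\<forall>i<l. H i \<in> A \<and> K i \<in> A) \<and>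
    (\<forall>w. tuple_norm l K w \<le> top_height w \<and> top_height w * tuple_norm l H w \<le> 1 \<and>
      top_height w * cmod (tuple_dot l H K w - 1) \<le> M * \<epsilon> k)"
    unfolding M_def by (intro allI tuples) (simp add: \<epsilon>_def)
  then obtain l H K where l: "\<And>k. l k \<ge> 1 \<and> (\<forall>i<l k. H k i \<in> A \<and> K k i \<in> A)"
    and t: "\<And>k w. tuple_norm (l k) (K k) w \<le> top_height w" "\<And>k w. top_height w * tuple_norm (l k) (H k) w \<le> 1"
      "\<And>k w. top_height w * cmod (tuple_dot (l k) (H k) (K k) w - 1) \<le> M * \<epsilon> k"
    by metis
  have le: "tuple_norm (l k) (K k) w \<le> Re (f w) \<and>
      ereal (Re (f w)) \<le> inverse (ereal (tuple_norm (l k) (H k) w))" for k w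
  proof
    have "0 \<le> tuple_norm (l k) (H k) w"
      by (simp add: tuple_norm_vnorm)
    then show "ereal (Re (f w)) \<le> inverse (ereal (tuple_norm (l k) (H k) w))"
      unfolding f_apply Re_complex_of_real using ereal_le_inverse_iff[OF top_height_nonneg] t(2) by blast
  qed (simp add: f_apply t)
  have lim: "uniform_limit C (\<lambda>k. tuple_dot (l k) (H k) (K k)) (\<lambda>_. 1) sequentially"
    if C: "compact C" "C \<subseteq> - {w. f w = 0}" for C
  proof (cases "C = {}")
    case False
    then obtain w0 where w0: "w0 \<in> C" "\<And>w. w \<in> C \<Longrightarrow> top_height w0 \<le> top_height w"
      using continuous_attains_inf[OF C(1), of top_height] continuous_top_height continuous_on_subset
      by blast
    define c where "c = top_height w0"
    have "c > 0"
      using w0(1) C(2) top_height_nonneg[of w0] by (auto simp: c_def f_apply order_le_less)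
    show ?thesis
    proof (rule uniform_limitI)
      fix e :: real assume "e > 0"
      then have "e * c / M > 0"
        using \<open>c > 0\<close> \<open>M > 0\<close> by simp
      then obtain m where m: "\<epsilon> m < e * c / M"
        unfolding \<epsilon>_def using reals_Archimedean by blast
      have "dist (tuple_dot (l k) (H k) (K k) w) 1 < e" if "k \<ge> m" "w \<in> C" for k w
      proof -
        have "\<epsilon> k \<le> \<epsilon> m"
          unfolding \<epsilon>_def using that(1) by (intro le_imp_inverse_le) simp_all
        then have "\<epsilon> k < e * c / M"
          using m by simp
        then have "M * \<epsilon> k < e * c"
          using \<open>M > 0\<close> by (simp add: field_simps)
        moreover have "c * cmod (tuple_dot (l k) (H k) (K k) w - 1) \<le> M * \<epsilon> k"
          using t(3)[of w k] mult_right_mono[OF w0(2)[OF that(2)]] unfolding c_def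
          by (meson norm_ge_zero order_trans)
        ultimately have "c * cmod (tuple_dot (l k) (H k) (K k) w - 1) < c * e"
          by (simp add: mult.commute)
        then show ?thesis
          using \<open>c > 0\<close> by (simp add: dist_norm)
      qed
      then show "\<forall>\<^sub>F k in sequentially. \<forall>w\<in>C. dist (tuple_dot (l k) (H k) (K k) w) 1 < e"
        unfolding eventually_sequentially by blast
    qed
  qed simp
  show ?thesis
    unfolding R_class_def mem_Collect_eq
  proof (intro conjI exI)
    show "\<forall>k. l k \<ge> 1 \<and> (\<forall>i<l k. H k i \<in> A \<and> K k i \<in> A)"
      using l by blast
    show "\<forall>k w. tuple_norm (l k) (K k) w \<le> Re (f w) \<and>
        ereal (Re (f w)) \<le> inverse (ereal (tuple_norm (l k) (H k) w))"
      using le by blast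
    show "\<forall>C. compact C \<and> C \<subseteq> - {w. f w = 0} \<longrightarrow>
        uniform_limit C (\<lambda>k. tuple_dot (l k) (H k) (K k)) (\<lambda>_. 1) sequentially"
      using lim by blast
  qed (simp_all add: f_apply)
qed

section \<open>Extension of the isometry from the multiples of the generator to the whole
  module\<close>

text \<open>The closure of the graph of \<open>a x0 \<mapsto> a * f\<close>. Working with a relation
  avoids a choice of \<open>a\<close> or of approximating sequences, and lets algebraic
  compatibility be proved before single-valuedness.\<close>

definition graph_closure :: "'x \<Rightarrow> ('w \<Rightarrow>\<^sub>C complex) \<Rightarrow> bool"
  where "graph_closure y g \<longleftrightarrow> (\<forall>e>0. \<exists>a\<in>A. norm1 X (y - act X a x0) < e \<and> norm (g - a * f) < e)"

lemma graph_closureI: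
  assumes "\<And>k. a k \<in> A" "(\<lambda>k. norm1 X (y - act X (a k) x0)) \<longlonglongrightarrow> 0" "(\<lambda>k. norm (g - a k * f)) \<longlonglongrightarrow> 0"
  shows "graph_closure y g"
  unfolding graph_closure_def
proof (intro allI impI)
  fix e :: real assume "e > 0"
  have "\<forall>\<^sub>F k in sequentially. norm1 X (y - act X (a k) x0) < e \<and> norm (g - a k * f) < e"
    using order_tendstoD(2)[OF assms(2) \<open>e > 0\<close>] order_tendstoD(2)[OF assms(3) \<open>e > 0\<close>]
    by (rule eventually_conj)
  then obtain k where "norm1 X (y - act X (a k) x0) < e \<and> norm (g - a k * f) < e"
    using eventually_happens sequentially_bot by blast
  then show "\<exists>a\<in>A. norm1 X (y - act X a x0) < e \<and> norm (g - a * f) < e"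
    using assms(1) by blast
qed

lemma graph_closureE:
  assumes "graph_closure y g" "y \<in> carr X"
  obtains a where "\<And>k. a k \<in> A" "(\<lambda>k. norm1 X (y - act X (a k) x0)) \<longlonglongrightarrow> 0"
    "(\<lambda>k. norm (g - a k * f)) \<longlonglongrightarrow> 0"
proof -
  have "\<forall>k. \<exists>a\<in>A. norm1 X (y - act X a x0) < inverse (real (Suc k)) \<and> norm (g - a * f) < inverse (real (Suc k))"
    using assms(1) by (simp add: graph_closure_def)
  then obtain a where a: "\<And>k. a k \<in> A" "\<And>k. norm1 X (y - act X (a k) x0) < inverse (real (Suc k))"
    "\<And>k. norm (g - a k * f) < inverse (real (Suc k))"
    by metis
  have "(\<lambda>k. norm1 X (y - act X (a k) x0)) \<longlonglongrightarrow> 0"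
    by (rule tendsto_sandwich[OF _ _ tendsto_const LIMSEQ_inverse_real_of_nat])
      (auto intro!: always_eventually less_imp_le a(2) norm1_nonneg diff_closed act_closed assms(2) a(1) x0
        simp del: of_nat_Suc)
  moreover have "(\<lambda>k. norm (g - a k * f)) \<longlonglongrightarrow> 0"
    by (rule tendsto_sandwich[OF _ _ tendsto_const LIMSEQ_inverse_real_of_nat])
      (auto intro!: always_eventually less_imp_le a(3) simp del: of_nat_Suc)
  ultimately show thesis
    using that a(1) by blast
qed

text \<open>The identity \<open>norm1_act_x0\<close> survives the limit because both norms are
  continuous.\<close>

lemma graph_closure_norm:
  assumes "graph_closure y g" "y \<in> carr X"
  shows "norm1 X y = norm g"
proof -
  obtain a where a: "\<And>k. a k \<in> A" "(\<lambda>k. norm1 X (y - act X (a k) x0)) \<longlonglongrightarrow> 0"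
    "(\<lambda>k. norm (g - a k * f)) \<longlonglongrightarrow> 0"
    using graph_closureE[OF assms] by blast
  have ax: "act X (a k) x0 \<in> carr X" for k
    by (rule act_closed[OF a(1) x0])
  have "\<bar>norm1 X y - norm g\<bar> \<le> norm1 X (y - act X (a k) x0) + norm (g - a k * f)" for k
    using norm1_triangle_sub[OF assms(2) ax[of k]] norm1_triangle_sub[OF ax[of k] assms(2)]
      norm1_diff_commute[OF ax[of k] assms(2)] norm_triangle_ineq3[of g "a k * f"]
    by (simp add: norm1_act_x0[OF a(1)])
  moreover have "(\<lambda>k. norm1 X (y - act X (a k) x0) + norm (g - a k * f)) \<longlonglongrightarrow> 0"
    using tendsto_add[OF a(2,3)] by simp
  ultimately have "\<bar>norm1 X y - norm g\<bar> \<le> 0"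
    by (intro LIMSEQ_le_const) auto
  then show ?thesis
    by simp
qed

lemma graph_closure_add:
  assumes "graph_closure y g" "graph_closure y' g'" and y: "y \<in> carr X" "y' \<in> carr X"
  shows "graph_closure (y + y') (g + g')"
  unfolding graph_closure_def
proof (intro allI impI)
  fix e :: real assume "e > 0"
  then obtain a b where a: "a \<in> A" "norm1 X (y - act X a x0) < e / 2" "norm (g - a * f) < e / 2"
    and b: "b \<in> A" "norm1 X (y' - act X b x0) < e / 2" "norm (g' - b * f) < e / 2"
    using assms(1,2) unfolding graph_closure_def by (meson half_gt_zero)
  have "y - act X a x0 \<in> carr X" "y' - act X b x0 \<in> carr X"
    using a b y x0 by (simp_all add: diff_closed act_closed)
  then have "norm1 X ((y - act X a x0) + (y' - act X b x0)) < e"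
    using norm1_triangle[of "y - act X a x0" "y' - act X b x0"] a(2) b(2) by simp
  moreover have "(y - act X a x0) + (y' - act X b x0) = (y + y') - act X (a + b) x0"
    using a b x0 by (simp add: act_add_left)
  moreover have "norm ((g - a * f) + (g' - b * f)) < e"
    using norm_triangle_ineq[of "g - a * f" "g' - b * f"] a(3) b(3) by simp
  moreover have "(g - a * f) + (g' - b * f) = (g + g') - (a + b) * f"
    by (simp add: algebra_simps)
  ultimately show "\<exists>a\<in>A. norm1 X (y + y' - act X a x0) < e \<and> norm (g + g' - a * f) < e"
    using A_add[OF a(1) b(1)] by (intro bexI[of _ "a + b"]) simp_all
qed

lemma graph_closure_act:
  assumes "graph_closure y g" and y: "y \<in> carr X" and b: "b \<in> A"
  shows "graph_closure (act X b y) (b * g)"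
  unfolding graph_closure_def
proof (intro allI impI)
  fix e :: real assume "e > 0"
  define B where "B = norm b + 1"
  have "B > 0"
    unfolding B_def by (rule add_nonneg_pos) simp_all
  obtain a where a: "a \<in> A" "norm1 X (y - act X a x0) < e / B" "norm (g - a * f) < e / B"
    using assms(1) \<open>e > 0\<close> \<open>B > 0\<close> unfolding graph_closure_def by (meson divide_pos_pos)
  have ya: "y - act X a x0 \<in> carr X"
    using a y x0 by (simp add: diff_closed act_closed)
  have "act X b y - act X (b * a) x0 = act X b (y - act X a x0)"
    using a b y x0 by (simp add: act_diff_right act_mult act_closed)
  also have "norm1 X \<dots> \<le> B * norm1 X (y - act X a x0)"
    using norm1_act[OF b ya] norm1_nonneg[OF ya] by (simp add: B_def algebra_simps)
  also have "\<dots> < e"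
    using a(2) \<open>B > 0\<close> by (simp add: field_simps)
  finally have "norm1 X (act X b y - act X (b * a) x0) < e" .
  moreover have "norm (b * g - (b * a) * f) < e"
  proof -
    have "b * g - (b * a) * f = b * (g - a * f)"
      by (simp add: algebra_simps)
    also have "norm \<dots> \<le> norm b * norm (g - a * f)"
      by (rule norm_mult_ineq)
    also have "\<dots> \<le> B * norm (g - a * f)"
      by (simp add: B_def mult_right_mono)
    also have "\<dots> < e"
      using a(3) \<open>B > 0\<close> by (simp add: field_simps)
    finally show ?thesis .
  qed
  ultimately show "\<exists>a\<in>A. norm1 X (act X b y - act X a x0) < e \<and> norm (b * g - a * f) < e"
    using A_mult[OF b a(1)] by blast
qed

text \<open>The relation is compatible with differences, so 0 is related to \<open>g - g'\<close>,
  and related elements have equal norms.\<close>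

lemma graph_closure_unique:
  assumes "graph_closure y g" "graph_closure y g'" "y \<in> carr X"
  shows "g = g'"
proof -
  \<comment> \<open>Negation is reached through the action of the constant -1.\<close>
  have "graph_closure (act X (- 1) y) (- 1 * g')"
    by (intro graph_closure_act assms uminus_in_uniform_algebra[OF A] A_one)
  moreover have "act X (- 1) y = - y"
    using act_add_left[of "- 1" 1 y] act_diff_left[of 1 1 y] uminus_in_uniform_algebra[OF A A_one] A_one
      assms(3) act_one by (simp add: eq_neg_iff_add_eq_0)
  ultimately have "graph_closure (y + - y) (g + - 1 * g')"
    using assms by (intro graph_closure_add) (simp_all add: uminus_closed)
  then have "norm1 X 0 = norm (g - g')"
    using graph_closure_norm zero_closed by simp
  then show ?thesis
    by (simp add: norm1_zero)
qed

text \<open>Multiples of the generator approximate \<open>y\<close>; by the norm identity the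
  corresponding \<open>a k * f\<close> form a Cauchy sequence, and completeness of the continuous
  functions provides \<open>g\<close>.\<close>

lemma graph_closure_total:
  assumes y: "y \<in> carr X"
  shows "\<exists>g. graph_closure y g"
proof -
  have "\<forall>k. \<exists>a\<in>A. norm1 X (y - act X a x0) < inverse (real (Suc k))"
    using generates[OF y] by simp
  then obtain a where a: "\<And>k. a k \<in> A" "\<And>k. norm1 X (y - act X (a k) x0) < inverse (real (Suc k))"
    by metis
  have ax: "act X (a k) x0 \<in> carr X" for k
    by (rule act_closed[OF a(1) x0])
  have lim: "(\<lambda>k. norm1 X (y - act X (a k) x0)) \<longlonglongrightarrow> 0"
    by (rule tendsto_sandwich[OF _ _ tendsto_const LIMSEQ_inverse_real_of_nat])
      (auto intro!: always_eventually less_imp_le a(2) norm1_nonneg diff_closed ax y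
        simp del: of_nat_Suc)
  have dist: "dist (a k * f) (a m * f) \<le> norm1 X (y - act X (a k) x0) + norm1 X (y - act X (a m) x0)" for k m
  proof -
    have "dist (a k * f) (a m * f) = norm ((a k - a m) * f)"
      by (simp add: dist_norm left_diff_distrib)
    also have "\<dots> = norm1 X (act X (a k) x0 - act X (a m) x0)"
      by (simp add: norm1_act_x0[symmetric] A_diff a(1) act_diff_left x0)
    also have "\<dots> \<le> norm1 X (y - act X (a k) x0) + norm1 X (y - act X (a m) x0)"
      using norm1_triangle_diff[OF ax[of k] y ax[of m]] norm1_diff_commute[OF ax[of k] y] by simp
    finally show ?thesis .
  qed
  have "Cauchy (\<lambda>k. a k * f)"
  proof (rule metric_CauchyI)
    fix e :: real assume "e > 0"
    then obtain N where N: "\<And>k. k \<ge> N \<Longrightarrow> norm1 X (y - act X (a k) x0) < e / 2"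
      using order_tendstoD(2)[OF lim, of "e / 2"] unfolding eventually_sequentially by auto
    have "dist (a k * f) (a m * f) < e" if "k \<ge> N" "m \<ge> N" for k m
      using dist[of k m] N[OF that(1)] N[OF that(2)] by linarith
    then show "\<exists>N. \<forall>k\<ge>N. \<forall>m\<ge>N. dist (a k * f) (a m * f) < e"
      by blast
  qed
  then obtain g where g: "(\<lambda>k. a k * f) \<longlonglongrightarrow> g"
    using Cauchy_bcontfun_convergent by (auto simp: convergent_def)
  have "(\<lambda>k. norm (g - a k * f)) \<longlonglongrightarrow> 0"
    using tendsto_norm_zero[OF LIM_zero[OF g]] by (simp add: norm_minus_commute)
  then show ?thesis
    using graph_closureI[OF a(1) lim] by blast
qed

text \<open>The mirror image of \<open>graph_closure_total\<close>, with completeness of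
  \<open>X\<close> providing the limit.\<close>

lemma graph_closure_onto:
  assumes g: "g \<in> closure ((\<lambda>a. a * f) ` A)"
  shows "\<exists>y\<in>carr X. graph_closure y g"
proof -
  obtain s where s: "\<And>k. s k \<in> (\<lambda>a. a * f) ` A" "s \<longlonglongrightarrow> g"
    using closure_sequenceE[OF g] by blast
  then have "\<forall>k. \<exists>a\<in>A. s k = a * f"
    by blast
  then obtain a where a: "\<And>k. a k \<in> A" "\<And>k. s k = a k * f"
    by metis
  have ax: "act X (a k) x0 \<in> carr X" for k
    by (rule act_closed[OF a(1) x0])
  have "norm1 X (act X (a k) x0 - act X (a m) x0) = norm (s k - s m)" for k m
  proof -
    have "norm1 X (act X (a k) x0 - act X (a m) x0) = norm ((a k - a m) * f)"
      by (simp add: norm1_act_x0[symmetric] A_diff a(1) act_diff_left x0)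
    then show ?thesis
      by (simp add: a(2) left_diff_distrib)
  qed
  moreover have "\<forall>e>0. \<exists>N. \<forall>k\<ge>N. \<forall>m\<ge>N. norm (s k - s m) < e"
    using LIMSEQ_imp_Cauchy[OF s(2)] by (simp add: Cauchy_def dist_norm)
  ultimately obtain y where y: "y \<in> carr X" "(\<lambda>k. norm1 X (act X (a k) x0 - y)) \<longlonglongrightarrow> 0"
    using complete[of "\<lambda>k. act X (a k) x0"] ax by auto
  have "(\<lambda>k. norm1 X (y - act X (a k) x0)) \<longlonglongrightarrow> 0"
    using y(2) by (simp add: norm1_diff_commute[OF y(1) ax])
  moreover have "(\<lambda>k. norm (g - a k * f)) \<longlonglongrightarrow> 0"
    using tendsto_norm_zero[OF LIM_zero[OF s(2)]] by (simp add: norm_minus_commute a(2))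
  ultimately show ?thesis
    using graph_closureI[of a] a(1) y(1) by blast
qed

lemma graph_closure_in_closure:
  assumes "graph_closure y g"
  shows "g \<in> closure ((\<lambda>a. a * f) ` A)"
  unfolding closure_approachable
proof (intro allI impI)
  fix e :: real assume "e > 0"
  then obtain a where "a \<in> A" "norm (g - a * f) < e"
    using assms unfolding graph_closure_def by blast
  then show "\<exists>h\<in>(\<lambda>a. a * f) ` A. dist h g < e"
    by (auto simp: dist_norm norm_minus_commute)
qed

lemma A_isometric_closed_span: "A_isometric A X (closed_span A f)"
proof -
  define T where "T y = (THE g. graph_closure y g)" for y
  have T: "T y = g" if "graph_closure y g" "y \<in> carr X" for y g
    unfolding T_def by (rule the_equality) (use that graph_closure_unique in \<open>simp_all\<close>)
  have graph: "graph_closure y (T y)" if "y \<in> carr X" for y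
    using graph_closure_total[OF that] T[OF _ that] by metis
  \<comment> \<open>Complex scaling is the action of constants, so homogeneity is a case of
    linearity over \<open>A\<close>.\<close>
  have scale: "cscale X c y = act X (const_bcontfun c) y" if "y \<in> carr X" for c y
    using act_scale_left[OF A_one that, of c] act_one[OF that] by simp
  have "module_map A X (closed_span A f) T"
    unfolding module_map_def
  proof (intro conjI ballI allI)
    fix y y' c a assume y: "y \<in> carr X"
    show "T y \<in> carr (closed_span A f)"
      using graph_closure_in_closure[OF graph[OF y]] by simp
    show "T (y + y') = T y + T y'" if y': "y' \<in> carr X"
      by (intro T graph_closure_add graph add_closed y y')
    show T_act: "T (act X a y) = act (closed_span A f) a (T y)" if "a \<in> A" for a
      unfolding act_closed_span by (intro T graph_closure_act graph act_closed y that)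
    show "T (cscale X c y) = cscale (closed_span A f) c (T y)"
      using T_act[OF A_const] unfolding scale[OF y] by (simp add: closed_span_def)
  qed
  moreover have "T ` carr X = carr (closed_span A f)"
  proof
    show "T ` carr X \<subseteq> carr (closed_span A f)"
      using graph_closure_in_closure[OF graph] by auto
    show "carr (closed_span A f) \<subseteq> T ` carr X"
    proof
      fix g assume "g \<in> carr (closed_span A f)"
      then obtain y where "y \<in> carr X" "graph_closure y g"
        using graph_closure_onto unfolding carr_closed_span by blast
      then show "g \<in> T ` carr X"
        using T by (intro image_eqI[of _ _ y]) simp_all
    qed
  qed
  moreover have "\<forall>y\<in>carr X. norm1 (closed_span A f) (T y) = norm1 X y"
    using graph_closure_norm[OF graph] by simp
  ultimately show ?thesis
    unfolding A_isometric_def by blast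
qed

end

lemma A_isometric_closed_span_R_class:
  fixes X :: "('w::t2_space, 'x::ab_group_add) op_mod"
  assumes A: "uniform_algebra A" and X: "rigged A X" "singly_generated A X"
  shows "\<exists>E f. closed E \<and> f \<in> R_class A E \<and> A_isometric A X (closed_span A f)"
proof -
  obtain x0 where x0: "x0 \<in> carr X" "\<forall>y\<in>carr X. \<forall>e>0. \<exists>a\<in>A. norm1 X (y - act X a x0) < e"
    using X(2) unfolding singly_generated_def by blast
  obtain D :: "('w, 'x) rig_index set" and le n \<phi> \<psi> where rig: "rigging A X D le n \<phi> \<psi>"
    using X(1) unfolding rigged_def by blast
  have dir: "directed_by D le"
    using rig by (simp add: rigging_def)
  interpret left_operator_module A X
    using X(1) by (simp add: rigged_def)
  have maps: "n i \<ge> 1 \<and>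
      module_map A X (row_module A (n i)) (\<phi> i) \<and>
      completely_contractive X (row_module A (n i)) (\<phi> i) \<and>
      module_map A (row_module A (n i)) X (\<psi> i) \<and>
      completely_contractive (row_module A (n i)) X (\<psi> i)" if "i \<in> D" for i
    using rig that unfolding rigging_def by blast
  interpret singly_generated_rigged A X x0 D n \<phi> \<psi>
  proof
    fix i assume i: "i \<in> D"
    show "n i \<ge> 1" "module_map A X (row_module A (n i)) (\<phi> i)" "module_map A (row_module A (n i)) X (\<psi> i)"
      using maps[OF i] by blast+
    show "norm1 (row_module A (n i)) (\<phi> i x) \<le> norm1 X x" if "x \<in> carr X" for x
      using maps[OF i] by (intro completely_contractive_norm1 that) blast
    show "norm1 X (\<psi> i t) \<le> norm1 (row_module A (n i)) t" if "t \<in> carr (row_module A (n i))" for t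
      using maps[OF i] by (intro completely_contractive_norm1 that) blast
  next
    fix x and e :: real assume x: "x \<in> carr X" and "e > 0"
    have "((\<lambda>i. norm1 X (\<psi> i (\<phi> i x) - x)) \<longlongrightarrow> 0) (tails D le)"
      using rig x unfolding rigging_def by blast
    then have "\<forall>\<^sub>F i in tails D le. norm1 X (\<psi> i (\<phi> i x) - x) < e"
      using \<open>e > 0\<close> by (rule order_tendstoD)
    then show "\<exists>i\<in>D. norm1 X (\<psi> i (\<phi> i x) - x) < e"
      using dir unfolding eventually_tails[OF dir] directed_by_def by blast
  qed (use A x0 in auto)
  have "closed {w. f w = 0}"
    by (intro closed_Collect_eq continuous_intros) simp
  then show ?thesis
    by (intro exI[of _ "{w. f w = 0}"] exI[of _ f] conjI f_in_R_class A_isometric_closed_span)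
qed

theorem corollary8p9:
  fixes A :: "('w::t2_space \<Rightarrow>\<^sub>C complex) set"
  assumes "compact (UNIV :: 'w set)"
    and "uniform_algebra A"
  shows "(\<forall>X :: ('w, 'x::ab_group_add) op_mod.
            rigged A X \<and> singly_generated A X \<longrightarrow>
              (\<exists>E f. closed E \<and> f \<in> R_class A E \<and> A_isometric A X (closed_span A f))) \<and>
         (\<forall>E f. closed E \<and> f \<in> R_class A E \<longrightarrow>
            rigged A (closed_span A f) \<and> singly_generated A (closed_span A f))"
proof (intro conjI allI impI; elim conjE)
  show "\<exists>E f. closed E \<and> f \<in> R_class A E \<and> A_isometric A X (closed_span A f)"
    if "rigged A X" "singly_generated A X" for X :: "('w, 'x) op_mod"
    using assms(2) that by (rule A_isometric_closed_span_R_class)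
next
  fix E f assume "f \<in> R_class A E"
  then show "rigged A (closed_span A f)"
    by (rule rigged_closed_span_R_class[OF assms])
  show "singly_generated A (closed_span A f)"
    by (rule singly_generated_closed_span[OF assms(2)])
qed

end
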